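(* Let $N\geq 1$ be an integer and let $V$ be the real vector space of pairs $(\mu,z)$, where $\mu=(\mu_{ij})_{1\le i,j\le N}$ is a complex $N\times N$ matrix with $\mu_{ij}=\overline{\mu_{ji}}$, and $z=(z_{ij,kl})_{1\le i,j,k,l\le N}$ is a complex array satisfying $z_{ij,kl}=z_{kl,ij}=\overline{z_{ji,lk}}$. (These are the coefficients of the general $N$-Higgs-doublet potential $V_H=\mu_{ij}(\Phi_i^\dagger\Phi_j)+z_{ij,kl}(\Phi_i^\dagger\Phi_j)(\Phi_k^\dagger\Phi_l)$, and $\dim_{\mathbb R}V=N^2(N^2+3)/2$.) Let $G=\mathrm{SU}(N)$ act on $V$ by basis changes of the doublets, $$\mu_{ij}\mapsto U_{ia}\overline{U_{jb}}\,\mu_{ab},\qquad z_{ij,kl}\mapsto U_{ia}\overline{U_{jb}}\,U_{kc}\overline{U_{ld}}\,z_{ab,cd},\qquad U\in \mathrm{SU}(N)$$ (summation over repeated indices), and extend this action complex-linearly to the complexification $V_{\mathbb C}=V\otimes_{\mathbb R}\mathbb C$. Then the Krull dimension of the ring of invariants $\mathbb C[V_{\mathbb C}]^{G}$ (the number of physical parameters of the NHDM) equals $$\frac{N^4+N^2+2}{2}.$$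
   Context: $\mathbb C[V_{\mathbb C}]$ denotes the ring of polynomial functions on $V_{\mathbb C}$, with $G$ acting by $(g.f)(v)=f(g^{-1}v)$, and $\mathbb C[V_{\mathbb C}]^G$ is the subring of $G$-invariant polynomials. The Krull dimension of this (finitely generated) ring equals the maximal number of algebraically independent invariants; the paper calls it the number of physical parameters of the $N$-Higgs-doublet model (NHDM). *)

theory Defs
  imports Complex_Main "HOL-Combinatorics.Permutations" "HOL-Library.Extended_Nat"
begin

text \<open>Coordinates of the complexified parameter space. Indices run over 0..N-1.
  Mu i j is the coordinate mu_ij, Z i j k l is the coordinate z_{ij,kl}.\<close>
datatype idx = Mu nat nat | Z nat nat nat nat

type_synonym point = "idx \<Rightarrow> complex"

text \<open>The complexification V_C of V: complexifying Hermitian matrices gives all complex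
  N x N matrices, and complexifying the arrays with z_ij,kl = z_kl,ij = cnj z_ji,lk gives
  all complex arrays with z_ij,kl = z_kl,ij. Out-of-range coordinates are zero.\<close>
definition VC :: "nat \<Rightarrow> point set" where
  "VC N = {v. (\<forall>i j. (N \<le> i \<or> N \<le> j) \<longrightarrow> v (Mu i j) = 0)
            \<and> (\<forall>i j k l. (N \<le> i \<or> N \<le> j \<or> N \<le> k \<or> N \<le> l) \<longrightarrow> v (Z i j k l) = 0)
            \<and> (\<forall>i j k l. v (Z i j k l) = v (Z k l i j))}"

definition SU :: "nat \<Rightarrow> (nat \<Rightarrow> nat \<Rightarrow> complex) set" where
  "SU N = {U. (\<forall>i j. (N \<le> i \<or> N \<le> j) \<longrightarrow> U i j = 0)
           \<and> (\<forall>i<N. \<forall>j<N. (\<Sum>k<N. U i k * cnj (U j k)) = (if i = j then 1 else 0))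
           \<and> (\<Sum>p | p permutes {..<N}. of_int (sign p) * (\<Prod>i<N. U i (p i))) = 1}"

definition act :: "nat \<Rightarrow> (nat \<Rightarrow> nat \<Rightarrow> complex) \<Rightarrow> point \<Rightarrow> point" where
  "act N U v = (\<lambda>x. case x of
      Mu i j \<Rightarrow> (\<Sum>a<N. \<Sum>b<N. U i a * cnj (U j b) * v (Mu a b))
    | Z i j k l \<Rightarrow> (\<Sum>a<N. \<Sum>b<N. \<Sum>c<N. \<Sum>d<N.
          U i a * cnj (U j b) * U k c * cnj (U l d) * v (Z a b c d)))"

inductive_set polyfun :: "(point \<Rightarrow> complex) set" where
  const: "(\<lambda>v. c) \<in> polyfun"
| coord: "(\<lambda>v. v x) \<in> polyfun"
| add: "f \<in> polyfun \<Longrightarrow> g \<in> polyfun \<Longrightarrow> (\<lambda>v. f v + g v) \<in> polyfun"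
| mult: "f \<in> polyfun \<Longrightarrow> g \<in> polyfun \<Longrightarrow> (\<lambda>v. f v * g v) \<in> polyfun"

definition restr :: "nat \<Rightarrow> (point \<Rightarrow> complex) \<Rightarrow> point \<Rightarrow> complex" where
  "restr N f = (\<lambda>v. if v \<in> VC N then f v else 0)"

text \<open>The ring C[V_C]^G of SU(N)-invariant polynomial functions on V_C, with pointwise
  operations. (Invariance f(g^{-1} v) = f(v) for all g is the same as f(g v) = f(v) for all g.)\<close>
definition inv_ring :: "nat \<Rightarrow> (point \<Rightarrow> complex) set" where
  "inv_ring N = {restr N f | f. f \<in> polyfun \<and>
                   (\<forall>U\<in>SU N. \<forall>v\<in>VC N. f (act N U v) = f v)}"

definition is_ideal :: "('a \<Rightarrow> complex) set \<Rightarrow> ('a \<Rightarrow> complex) set \<Rightarrow> bool" where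
  "is_ideal R I \<longleftrightarrow> I \<subseteq> R \<and> (\<lambda>v. 0) \<in> I
     \<and> (\<forall>a\<in>I. \<forall>b\<in>I. (\<lambda>v. a v + b v) \<in> I)
     \<and> (\<forall>a\<in>I. (\<lambda>v. - a v) \<in> I)
     \<and> (\<forall>r\<in>R. \<forall>a\<in>I. (\<lambda>v. r v * a v) \<in> I)"

definition is_prime_ideal :: "('a \<Rightarrow> complex) set \<Rightarrow> ('a \<Rightarrow> complex) set \<Rightarrow> bool" where
  "is_prime_ideal R P \<longleftrightarrow> is_ideal R P \<and> P \<noteq> R
     \<and> (\<forall>a\<in>R. \<forall>b\<in>R. (\<lambda>v. a v * b v) \<in> P \<longrightarrow> a \<in> P \<or> b \<in> P)"

definition krull_dim :: "('a \<Rightarrow> complex) set \<Rightarrow> enat" where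
  "krull_dim R = Sup {enat n | n. \<exists>P :: nat \<Rightarrow> ('a \<Rightarrow> complex) set.
      (\<forall>i\<le>n. is_prime_ideal R (P i)) \<and> (\<forall>i<n. P i \<subset> P (Suc i))}"

end

theory Submission
  imports Defs "Jordan_Normal_Form.Char_Poly" "HOL-Computational_Algebra.Fundamental_Theorem_Algebra"
begin

text \<open>
  The linear slice S consists of the points with mu diagonal and
  z_(00,0k) = z_(00,k0); its dimension is the claimed number d. Diagonalising mu and then
  using diagonal phases, SU(N) moves every point of the real form V into S. As V is Zariski
  dense in its complexification, restriction of invariants to S is injective.

  A chain of n+1 primes yields n elements of the ring whose monomials are linearly independent;
  on S, the k^n monomials with all exponents below k lie in a space of dimension O(k^d), so n is at most d.

  For the lower bound, fix the base point of S with mu = diag(0, ..., N-1), z_(00,0k) = 1 for k > 0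
  and all other coordinates 0, and free the d coordinates of S one at a time: first the remaining
  entries of z, then the entries z_(00,0k), then the eigenvalues of mu. The invariants vanishing on
  these affine subspaces form primes. They are distinct, because at each stage some invariant isolates
  the freed coordinate: as long as mu is fixed, Lagrange polynomials in mu give the
  coordinate projectors, and traces built from z and these projectors produce z_(00,0k)^2 and, when all z_(00,0k) are 1,
  every entry of z; for the eigenvalues use det(c - mu).
\<close>

section \<open>Unitary diagonalisation\<close>

text \<open>Matrices are bare functions, in the format of \<open>SU\<close> and \<open>act\<close>.
  Entries with an index of at least n are arbitrary, so most identities below are asserted only for
  indices below n.\<close>

definition mm :: "nat \<Rightarrow> (nat \<Rightarrow> nat \<Rightarrow> complex) \<Rightarrow> (nat \<Rightarrow> nat \<Rightarrow> complex) \<Rightarrow> nat \<Rightarrow> nat \<Rightarrow> complex" where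
  "mm n A B = (\<lambda>i j. \<Sum>k<n. A i k * B k j)"

definition adj :: "(nat \<Rightarrow> nat \<Rightarrow> complex) \<Rightarrow> nat \<Rightarrow> nat \<Rightarrow> complex" where
  "adj A = (\<lambda>i j. cnj (A j i))"

definition unitary :: "nat \<Rightarrow> (nat \<Rightarrow> nat \<Rightarrow> complex) \<Rightarrow> bool" where
  "unitary n U \<longleftrightarrow> (\<forall>i<n. \<forall>j<n. mm n U (adj U) i j = (if i = j then 1 else 0))"

lemma mm_assoc: "mm n (mm n A B) C = mm n A (mm n B C)"
proof (intro ext)
  fix i j
  show "mm n (mm n A B) C i j = mm n A (mm n B C) i j"
    unfolding mm_def sum_distrib_left sum_distrib_right
    by (subst sum.swap) (simp add: mult.assoc)
qed

lemma mm_cong: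
  assumes "\<And>k. k < n \<Longrightarrow> A i k = A' i k" "\<And>k. k < n \<Longrightarrow> B k j = B' k j"
  shows "mm n A B i j = mm n A' B' i j"
  unfolding mm_def using assms by (intro sum.cong) auto

lemma mm_one_left: "i < n \<Longrightarrow> (\<And>k. k < n \<Longrightarrow> A i k = (if i = k then 1 else 0)) \<Longrightarrow> mm n A B i j = B i j"
  unfolding mm_def
  by (subst sum.cong[OF refl, of _ _ "\<lambda>k. if k = i then B k j else 0"]) auto

lemma mm_one_right: "j < n \<Longrightarrow> (\<And>k. k < n \<Longrightarrow> B k j = (if k = j then 1 else 0)) \<Longrightarrow> mm n A B i j = A i j"
  unfolding mm_def
  by (subst sum.cong[OF refl, of _ _ "\<lambda>k. if k = j then A i k else 0"]) auto

lemma adj_mm: "adj (mm n A B) = mm n (adj B) (adj A)"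
  by (simp add: adj_def mm_def mult.commute)

text \<open>A one-sided inverse of a square matrix is two-sided; the fact is imported from
  \<open>carrier_mat\<close> matrices.\<close>

lemma unitary_adj:
  assumes "unitary n U" "i < n" "j < n"
  shows "mm n (adj U) U i j = (if i = j then 1 else 0)"
proof -
  define M where "M = mat n n (\<lambda>(i, j). U i j)"
  define M' where "M' = mat n n (\<lambda>(i, j). adj U i j)"
  have M: "M \<in> carrier_mat n n" "M' \<in> carrier_mat n n"
    by (auto simp: M_def M'_def)
  have "M * M' = 1\<^sub>m n"
    using assms(1) unfolding unitary_def mm_def
    by (intro eq_matI) (auto simp: M_def M'_def scalar_prod_def lessThan_atLeast0)
  then have "M' * M = 1\<^sub>m n"
    using mat_mult_left_right_inverse M by blast
  then have "(M' * M) $$ (i, j) = 1\<^sub>m n $$ (i, j)" by simp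
  then show ?thesis using assms(2,3)
    by (auto simp: M_def M'_def scalar_prod_def mm_def lessThan_atLeast0)
qed

lemma unitary_mm:
  assumes "unitary n U" "unitary n V"
  shows "unitary n (mm n U V)"
  unfolding unitary_def
proof (intro allI impI)
  fix i j assume ij: "i < n" "j < n"
  have "mm n (mm n U V) (adj (mm n U V)) i j = mm n U (mm n (mm n V (adj V)) (adj U)) i j"
    by (simp add: adj_mm mm_assoc)
  also have "\<dots> = mm n U (adj U) i j"
    using assms(2) by (intro mm_cong refl mm_one_left) (auto simp: unitary_def)
  finally show "mm n (mm n U V) (adj (mm n U V)) i j = (if i = j then 1 else 0)"
    using assms(1) ij by (auto simp: unitary_def)
qed

lemma eigenvector_exists:
  fixes A :: "nat \<Rightarrow> nat \<Rightarrow> complex"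
  assumes "0 < n"
  shows "\<exists>e v. (\<exists>i<n. v i \<noteq> 0) \<and> (\<forall>i<n. (\<Sum>j<n. A i j * v j) = e * v i)"
proof -
  define M where "M = mat n n (\<lambda>(i, j). A i j)"
  have M: "M \<in> carrier_mat n n" by (simp add: M_def)
  have "degree (char_poly M) = n" using M by (rule degree_monic_char_poly[THEN conjunct1])
  then have "\<not> constant (poly (char_poly M))"
    using assms by (simp add: constant_degree)
  then obtain e where "poly (char_poly M) e = 0"
    using fundamental_theorem_of_algebra by blast
  then have "eigenvalue M e" using eigenvalue_root_char_poly[OF M] by simp
  then obtain v where v: "v \<in> carrier_vec n" "v \<noteq> 0\<^sub>v n" "M *\<^sub>v v = e \<cdot>\<^sub>v v"
    using M unfolding eigenvalue_def eigenvector_def by auto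
  have "\<exists>i<n. v $ i \<noteq> 0"
    using v(1,2) by (metis carrier_vecD eq_vecI index_zero_vec)
  moreover have "(\<Sum>j<n. A i j * v $ j) = e * v $ i" if "i < n" for i
  proof -
    have "(M *\<^sub>v v) $ i = e * v $ i" using v that by simp
    then show ?thesis using v(1) that
      by (simp add: M_def scalar_prod_def lessThan_atLeast0)
  qed
  ultimately show ?thesis by blast
qed

text \<open>The reflection in the hyperplane orthogonal to w = v - e_0 exchanges e_0 and v. Reality
  of \<open>v 0\<close> gives w^* w = 2 - 2 v_0, which makes the first column come out as v.\<close>

lemma householder:
  fixes v :: "nat \<Rightarrow> complex"
  assumes n: "0 < n" and v: "(\<Sum>i<n. v i * cnj (v i)) = 1" and real: "cnj (v 0) = v 0"
  shows "\<exists>H. unitary n H \<and> adj H = H \<and> (\<forall>i<n. H i 0 = v i)"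
proof -
  define d :: "nat \<Rightarrow> nat \<Rightarrow> complex" where "d = (\<lambda>i j. if i = j then 1 else 0)"
  define w where "w = (\<lambda>i. v i - d i 0)"
  define s where "s = (\<Sum>i<n. w i * cnj (w i))"
  \<comment> \<open>If v = e_0 then s = 0, and division by zero gives 0, so \<open>H\<close> is the
    identity, as it should be.\<close>
  define H where "H = (\<lambda>i j. d i j - 2 * w i * cnj (w j) / s)"
  have cnj_s: "cnj s = s" by (simp add: s_def mult.commute)
  have pick: "(\<Sum>i<n. d i 0 * f i) = f 0" for f
    by (subst sum.cong[OF refl, of _ _ "\<lambda>k. if k = 0 then f k else 0"]) (auto simp: d_def n)
  have "s = (\<Sum>i<n. v i * cnj (v i) - d i 0 * cnj (v i) - d i 0 * v i + d i 0 * 1)"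
    unfolding s_def w_def by (intro sum.cong) (auto simp: d_def algebra_simps)
  then have s: "s = 2 - 2 * v 0"
    unfolding sum.distrib sum_subtractf v pick by (simp add: real)
  have w0: "w i = 0" if "s = 0" "i < n" for i
  proof -
    have "(\<Sum>i<n. complex_of_real ((norm (w i))\<^sup>2)) = 0"
      using that(1) by (simp add: s_def complex_norm_square flip: of_real_power)
    then have "(\<Sum>i<n. (norm (w i))\<^sup>2) = 0"
      by (metis of_real_eq_0_iff of_real_sum)
    then show ?thesis using that(2) by (simp add: sum_nonneg_eq_0_iff)
  qed
  have adj: "adj H = H"
    by (auto simp: adj_def H_def d_def cnj_s intro!: ext)
  have "unitary n H" unfolding unitary_def adj
  proof (intro allI impI)
    fix i j assume ij: "i < n" "j < n"
    have "mm n H H i j = (\<Sum>k<n. d i k * d k j - (2 * cnj (w j) / s) * (d i k * w k)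
       - (2 * w i / s) * (d k j * cnj (w k)) + (4 * w i * cnj (w j) / s / s) * (w k * cnj (w k)))"
      unfolding mm_def H_def by (intro sum.cong) (auto simp: algebra_simps)
    also have "\<dots> = d i j - (2 * cnj (w j) / s) * w i - (2 * w i / s) * cnj (w j) + (4 * w i * cnj (w j) / s / s) * s"
    proof -
      have "(\<Sum>k<n. d i k * f k) = f i" for f
        using ij by (subst sum.cong[OF refl, of _ _ "\<lambda>k. if k = i then f k else 0"]) (auto simp: d_def)
      moreover have "(\<Sum>k<n. d k j * f k) = f j" for f
        using ij by (subst sum.cong[OF refl, of _ _ "\<lambda>k. if k = j then f k else 0"]) (auto simp: d_def)
      ultimately show ?thesis
        unfolding sum.distrib sum_subtractf sum_distrib_left[symmetric] s_def by simp
    qed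
    also have "\<dots> = d i j" by (cases "s = 0") (auto simp: field_simps)
    finally show "mm n H H i j = (if i = j then 1 else 0)" by (simp add: d_def)
  qed
  moreover have "H i 0 = v i" if "i < n" for i
  proof (cases "s = 0")
    case True
    then show ?thesis using w0[OF True that] by (simp add: H_def w_def)
  next
    case False
    have "- (2 * w i * cnj (w 0)) = s * w i" by (simp add: s w_def d_def real algebra_simps)
    then have "- (2 * w i * cnj (w 0) / s) = w i" using False by (simp add: field_simps)
    then show ?thesis by (simp add: H_def w_def algebra_simps)
  qed
  ultimately show ?thesis using adj by blast
qed

text \<open>Induction on the size: a Householder matrix whose first column is a unit eigenvector
  splits off a 1 x 1 block, and the complementary Hermitian block is diagonalised by the induction
  hypothesis.\<close>

lemma spectral_theorem:
  fixes A :: "nat \<Rightarrow> nat \<Rightarrow> complex"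
  assumes "\<And>i j. i < n \<Longrightarrow> j < n \<Longrightarrow> adj A i j = A i j"
  shows "\<exists>U. unitary n U \<and> (\<forall>i<n. \<forall>j<n. i \<noteq> j \<longrightarrow> mm n U (mm n A (adj U)) i j = 0)"
  using assms
proof (induction n arbitrary: A)
  case 0
  then show ?case by (auto simp: unitary_def)
next
  case (Suc n)
  let ?n = "Suc n"
  obtain e v where v: "\<exists>i<?n. v i \<noteq> 0" "\<And>i. i < ?n \<Longrightarrow> (\<Sum>j<?n. A i j * v j) = e * v i"
    using eigenvector_exists[of ?n A] by blast
  define r where "r = sqrt (\<Sum>i<?n. (norm (v i))\<^sup>2)"
  have r2: "r\<^sup>2 = (\<Sum>i<?n. (norm (v i))\<^sup>2)"
    unfolding r_def by (rule real_sqrt_pow2) (simp add: sum_nonneg)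
  have r: "r \<noteq> 0"
  proof
    assume "r = 0"
    then have "(\<Sum>i<?n. (norm (v i))\<^sup>2) = 0" using r2 by simp
    then have "\<forall>i\<in>{..<?n}. (norm (v i))\<^sup>2 = 0" by (subst (asm) sum_nonneg_eq_0_iff) auto
    then show False using v(1) by auto
  qed
  \<comment> \<open>This phase makes the first entry of the eigenvector real, as
    \<open>householder\<close> requires.\<close>
  define p where "p = (if v 0 = 0 then 1 else cnj (v 0) / norm (v 0))"
  define x where "x = (\<lambda>i. p * v i / r)"
  have p: "p * cnj p = 1"
    by (auto simp: p_def mult.commute complex_norm_square[symmetric] power2_eq_square norm_divide)
  have xs: "(\<Sum>i<?n. x i * cnj (x i)) = 1"
  proof -
    have "(\<Sum>i<?n. x i * cnj (x i)) = (\<Sum>i<?n. p * cnj p * complex_of_real ((norm (v i))\<^sup>2) / r\<^sup>2)"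
      unfolding x_def
      by (intro sum.cong refl, simp only: complex_norm_square)
        (simp add: power2_eq_square[of "complex_of_real r"])
    also have "\<dots> = complex_of_real (\<Sum>i<?n. (norm (v i))\<^sup>2) / r\<^sup>2"
      unfolding p by (simp add: sum_divide_distrib del: sum.lessThan_Suc)
    finally show ?thesis unfolding r2[symmetric] using r by simp
  qed
  have x0: "cnj (x 0) = x 0"
    by (auto simp: x_def p_def mult.commute)
  have xe: "(\<Sum>j<?n. A i j * x j) = e * x i" if "i < ?n" for i
  proof -
    have "(\<Sum>j<?n. A i j * x j) = (\<Sum>j<?n. A i j * v j) * p / r"
      unfolding sum_distrib_right sum_divide_distrib x_def by (intro sum.cong) auto
    then show ?thesis unfolding v(2)[OF that] by (simp add: x_def)
  qed
  obtain H where H: "unitary ?n H" "adj H = H" "\<And>i. i < ?n \<Longrightarrow> H i 0 = x i"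
    using householder[OF _ xs x0] by blast
  define A1 where "A1 = mm ?n H (mm ?n A H)"
  have A1: "A1 i 0 = (if i = 0 then e else 0)" if "i < ?n" for i
  proof -
    have "mm ?n A H k 0 = e * H k 0" if "k < ?n" for k
    proof -
      have "mm ?n A H k 0 = (\<Sum>j<?n. A k j * x j)"
        unfolding mm_def by (intro sum.cong refl) (metis H(3) lessThan_iff)
      then show ?thesis using xe[OF that] H(3)[OF that] by simp
    qed
    then have "A1 i 0 = mm ?n H (\<lambda>i j. e * H i j) i 0"
      unfolding A1_def by (intro mm_cong refl)
    also have "\<dots> = e * mm ?n H (adj H) i 0"
      by (simp add: mm_def H(2) sum_distrib_left mult_ac del: sum.lessThan_Suc)
    finally show ?thesis using H(1) that by (auto simp: unitary_def)
  qed
  have herm: "adj A1 i j = A1 i j" if "i < ?n" "j < ?n" for i j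
  proof -
    have "adj A1 i j = mm ?n H (mm ?n (adj A) H) i j"
      by (simp add: A1_def adj_mm H(2) mm_assoc)
    also have "\<dots> = A1 i j"
      unfolding A1_def by (intro mm_cong refl Suc.prems)
    finally show ?thesis .
  qed
  \<comment> \<open>Hermitian symmetry carries the vanishing of the first column over to the first
    row.\<close>
  have A1': "A1 0 j = (if j = 0 then e else 0)" if "j < ?n" for j
    using herm[of 0 j] A1[of j] A1[of 0] herm[of 0 0] that by (auto simp: adj_def split: if_splits)
  obtain U' where U': "unitary n U'"
    "\<And>i j. i < n \<Longrightarrow> j < n \<Longrightarrow> i \<noteq> j \<Longrightarrow> mm n U' (mm n (\<lambda>i j. A1 (Suc i) (Suc j)) (adj U')) i j = 0"
    using Suc.IH[of "\<lambda>i j. A1 (Suc i) (Suc j)"] herm by (auto simp: adj_def)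
  \<comment> \<open>The block matrix diag(1, U').\<close>
  define U2 where "U2 = (\<lambda>i j. case i of 0 \<Rightarrow> (case j of 0 \<Rightarrow> 1 | Suc j' \<Rightarrow> 0)
     | Suc i' \<Rightarrow> (case j of 0 \<Rightarrow> 0 | Suc j' \<Rightarrow> U' i' j'))"
  have "unitary ?n U2" unfolding unitary_def
  proof (intro allI impI)
    fix i j assume "i < ?n" "j < ?n"
    then show "mm ?n U2 (adj U2) i j = (if i = j then 1 else 0)"
      using U'(1)
      by (auto simp: mm_def adj_def U2_def unitary_def sum.lessThan_Suc_shift split: nat.splits simp del: sum.lessThan_Suc)
  qed
  then have "unitary ?n (mm ?n U2 H)" using H(1) by (rule unitary_mm)
  moreover have "mm ?n (mm ?n U2 H) (mm ?n A (adj (mm ?n U2 H))) i j = 0"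
    if "i < ?n" "j < ?n" "i \<noteq> j" for i j
  proof -
    have "mm ?n (mm ?n U2 H) (mm ?n A (adj (mm ?n U2 H))) = mm ?n U2 (mm ?n A1 (adj U2))"
      by (simp add: A1_def adj_mm H(2) mm_assoc)
    moreover have "mm ?n U2 (mm ?n A1 (adj U2)) i j = 0"
      using that U'(2) A1 A1'
      by (cases i; cases j)
        (auto simp: mm_def adj_def U2_def sum.lessThan_Suc_shift simp del: sum.lessThan_Suc)
    ultimately show ?thesis by simp
  qed
  ultimately show ?case by blast
qed

section \<open>Chains of primes and counting monomials\<close>

text \<open>Gaussian elimination: an unknown p with nonzero coefficient in the last equation is
  eliminated from the others, which leaves one equation and one unknown less.\<close>

lemma underdetermined_system:
  fixes a :: "'i \<Rightarrow> nat \<Rightarrow> 'k::field"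
  assumes "finite I" "m < card I"
  shows "\<exists>c. (\<exists>i\<in>I. c i \<noteq> 0) \<and> (\<forall>j<m. (\<Sum>i\<in>I. c i * a i j) = 0)"
  using assms
proof (induction m arbitrary: I a)
  case 0
  then show ?case by (intro exI[of _ "\<lambda>_. 1"]) (auto simp: card_gt_0_iff)
next
  case (Suc m)
  show ?case
  proof (cases "\<forall>i\<in>I. a i m = 0")
    case True
    obtain c where "\<exists>i\<in>I. c i \<noteq> 0" "\<forall>j<m. (\<Sum>i\<in>I. c i * a i j) = 0"
      using Suc.IH[of I a] Suc.prems by auto
    then show ?thesis using True by (intro exI[of _ c]) (auto simp: less_Suc_eq)
  next
    case False
    then obtain p where p: "p \<in> I" "a p m \<noteq> 0" by blast
    have I': "finite (I - {p})" "m < card (I - {p})" using Suc.prems p(1) by auto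
    obtain c where c: "\<exists>i\<in>I - {p}. c i \<noteq> 0"
      "\<And>j. j < m \<Longrightarrow> (\<Sum>i\<in>I - {p}. c i * (a i j - a i m / a p m * a p j)) = 0"
      using Suc.IH[OF I', of "\<lambda>i j. a i j - a i m / a p m * a p j"] by blast
    \<comment> \<open>The value of the unknown p forced by equation m.\<close>
    define q where "q = - (\<Sum>i\<in>I - {p}. c i * a i m) / a p m"
    have split: "(\<Sum>i\<in>I. (c(p := q)) i * a i j) = q * a p j + (\<Sum>i\<in>I - {p}. c i * a i j)" for j
      using sum.remove[OF Suc.prems(1) p(1), of "\<lambda>i. (c(p := q)) i * a i j"]
      by (simp cong: sum.cong_simp)
    have "(\<Sum>i\<in>I. (c(p := q)) i * a i j) = 0" if "j < Suc m" for j
    proof (cases "j = m")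
      case True
      then show ?thesis unfolding split using p by (simp add: q_def)
    next
      case False
      with that have j: "j < m" by linarith
      have "0 = (\<Sum>i\<in>I - {p}. c i * (a i j - a i m / a p m * a p j))"
        by (rule c(2)[OF j, symmetric])
      also have "\<dots> = (\<Sum>i\<in>I - {p}. c i * a i j - c i * a i m * (a p j / a p m))"
        by (intro sum.cong) (simp_all add: right_diff_distrib)
      also have "\<dots> = (\<Sum>i\<in>I - {p}. c i * a i j) + q * a p j"
        unfolding sum_subtractf q_def sum_distrib_right[symmetric] by simp
      finally show ?thesis unfolding split by (simp add: add.commute)
    qed
    moreover have "\<exists>i\<in>I. (c(p := q)) i \<noteq> 0" using c(1) by auto
    ultimately show ?thesis by blast
  qed
qed

text \<open>Polynomials in the coordinates from C with degree at most D in each variable separately.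
  With this bound the number of monomials is exactly (D + 1) ^ card C; \<open>PiE\<close> fixes the
  exponents outside C, so that the index set is finite.\<close>

definition box_poly :: "'b set \<Rightarrow> nat \<Rightarrow> (('b \<Rightarrow> complex) \<Rightarrow> complex) set" where
  "box_poly C D = {h. \<exists>a. \<forall>g. h g = (\<Sum>\<alpha>\<in>PiE C (\<lambda>_. {..D}). a \<alpha> * (\<Prod>x\<in>C. g x ^ \<alpha> x))}"

lemma box_poly_scale: "h \<in> box_poly C D \<Longrightarrow> (\<lambda>g. c * h g) \<in> box_poly C D"
proof -
  assume "h \<in> box_poly C D"
  then obtain a where "\<And>g. h g = (\<Sum>\<alpha>\<in>PiE C (\<lambda>_. {..D}). a \<alpha> * (\<Prod>x\<in>C. g x ^ \<alpha> x))"
    unfolding box_poly_def by blast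
  then show ?thesis unfolding box_poly_def
    by (intro CollectI exI[of _ "\<lambda>\<alpha>. c * a \<alpha>"]) (simp add: sum_distrib_left mult.assoc)
qed

lemma box_poly_sum:
  assumes "\<And>i. i \<in> I \<Longrightarrow> h i \<in> box_poly C D"
  shows "(\<lambda>g. \<Sum>i\<in>I. h i g) \<in> box_poly C D"
proof -
  have "\<forall>i\<in>I. \<exists>a. \<forall>g. h i g = (\<Sum>\<alpha>\<in>PiE C (\<lambda>_. {..D}). a \<alpha> * (\<Prod>x\<in>C. g x ^ \<alpha> x))"
    using assms unfolding box_poly_def by blast
  then obtain a where a: "\<And>i g. i \<in> I \<Longrightarrow> h i g = (\<Sum>\<alpha>\<in>PiE C (\<lambda>_. {..D}). a i \<alpha> * (\<Prod>x\<in>C. g x ^ \<alpha> x))"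
    by metis
  have "(\<Sum>i\<in>I. h i g) = (\<Sum>\<alpha>\<in>PiE C (\<lambda>_. {..D}). (\<Sum>i\<in>I. a i \<alpha>) * (\<Prod>x\<in>C. g x ^ \<alpha> x))" for g
    unfolding sum_distrib_right by (subst sum.swap) (simp add: a)
  then show ?thesis unfolding box_poly_def
    by (intro CollectI exI[of _ "\<lambda>\<alpha>. \<Sum>i\<in>I. a i \<alpha>"]) simp
qed

lemma box_poly_monomial:
  assumes "finite C" "\<And>x. x \<in> C \<Longrightarrow> \<alpha> x \<le> D"
  shows "(\<lambda>g. \<Prod>x\<in>C. g x ^ \<alpha> x) \<in> box_poly C D"
proof -
  let ?B = "PiE C (\<lambda>_. {..D})"
  have "finite ?B" using assms(1) by (simp add: finite_PiE)
  moreover have "restrict \<alpha> C \<in> ?B" using assms(2) by auto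
  ultimately have "(\<Sum>\<beta>\<in>?B. (if \<beta> = restrict \<alpha> C then 1 else 0) * (\<Prod>x\<in>C. g x ^ \<beta> x)) = (\<Prod>x\<in>C. g x ^ \<alpha> x)"
    for g :: "'a \<Rightarrow> complex"
    by (subst sum.cong[OF refl, of _ _ "\<lambda>\<beta>. if \<beta> = restrict \<alpha> C then \<Prod>x\<in>C. g x ^ \<alpha> x else 0"]) auto
  then show ?thesis unfolding box_poly_def
    by (intro CollectI exI[of _ "\<lambda>\<beta>. if \<beta> = restrict \<alpha> C then 1 else 0"]) simp
qed

lemma box_poly_mult:
  assumes "finite C" "h \<in> box_poly C D" "h' \<in> box_poly C D'"
  shows "(\<lambda>g. h g * h' g) \<in> box_poly C (D + D')"
proof -
  let ?m = "\<lambda>\<alpha> g. \<Prod>x\<in>C. g x ^ \<alpha> x"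
  obtain a where a: "\<And>g. h g = (\<Sum>\<alpha>\<in>PiE C (\<lambda>_. {..D}). a \<alpha> * ?m \<alpha> g)"
    using assms(2) unfolding box_poly_def by blast
  obtain b where b: "\<And>g. h' g = (\<Sum>\<alpha>\<in>PiE C (\<lambda>_. {..D'}). b \<alpha> * ?m \<alpha> g)"
    using assms(3) unfolding box_poly_def by blast
  have "h g * h' g = (\<Sum>\<alpha>\<in>PiE C (\<lambda>_. {..D}). \<Sum>\<beta>\<in>PiE C (\<lambda>_. {..D'}).
      (a \<alpha> * b \<beta>) * ?m (\<lambda>x. \<alpha> x + \<beta> x) g)" for g
    by (simp add: a b sum_product power_add prod.distrib mult_ac)
  moreover have "(\<lambda>g. \<Sum>\<alpha>\<in>PiE C (\<lambda>_. {..D}). \<Sum>\<beta>\<in>PiE C (\<lambda>_. {..D'}).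
      (a \<alpha> * b \<beta>) * ?m (\<lambda>x. \<alpha> x + \<beta> x) g) \<in> box_poly C (D + D')"
    by (intro box_poly_sum box_poly_scale box_poly_monomial assms(1) add_mono) auto
  ultimately show ?thesis by simp
qed

lemma box_poly_const: "finite C \<Longrightarrow> (\<lambda>g. c) \<in> box_poly C D"
  using box_poly_scale[OF box_poly_monomial[of C "\<lambda>_. 0" D], of c] by simp

lemma box_poly_coord:
  assumes "finite C" "x \<in> C"
  shows "(\<lambda>g. g x) \<in> box_poly C 1"
proof -
  have "(\<Prod>y\<in>C. g y ^ (if y = x then 1 else 0)) = g x" for g :: "'a \<Rightarrow> complex"
  proof -
    have "(\<Prod>y\<in>C. g y ^ (if y = x then 1 else 0)) = (\<Prod>y\<in>C. if y = x then g y else 1)"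
      by (intro prod.cong) auto
    then show ?thesis using assms by simp
  qed
  then show ?thesis
    using box_poly_monomial[OF assms(1), of "\<lambda>y. if y = x then 1 else 0" 1] by simp
qed

lemma box_poly_mono:
  assumes "finite C" "h \<in> box_poly C D" "D \<le> D'"
  shows "h \<in> box_poly C D'"
  using box_poly_mult[OF assms(1,2) box_poly_const[OF assms(1), of 1 "D' - D"]] assms(3) by simp

lemma box_poly_add:
  assumes "finite C" "h \<in> box_poly C D" "h' \<in> box_poly C D'"
  shows "(\<lambda>g. h g + h' g) \<in> box_poly C (D + D')"
proof -
  have "(\<lambda>g. \<Sum>i\<in>{False, True}. (if i then h else h') g) \<in> box_poly C (D + D')"
    using assms by (intro box_poly_sum) (auto intro: box_poly_mono)
  then show ?thesis by (simp add: add.commute)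
qed

lemma box_poly_power:
  assumes "finite C" "h \<in> box_poly C D"
  shows "(\<lambda>g. h g ^ k) \<in> box_poly C (k * D)"
  by (induction k) (use assms in \<open>auto intro!: box_poly_const box_poly_mult\<close>)

text \<open>Vanishing of the coefficient of every monomial imposes (D + 1) ^ card C linear
  conditions on K unknowns.\<close>

lemma box_poly_dependent:
  assumes C: "finite C" and e: "\<And>i. i < K \<Longrightarrow> e i \<in> box_poly C D" and K: "(D + 1) ^ card C < K"
  shows "\<exists>c. (\<exists>i<K. c i \<noteq> 0) \<and> (\<forall>g. (\<Sum>i<K. c i * e i g) = 0)"
proof -
  let ?B = "PiE C (\<lambda>_. {..D})" and ?m = "\<lambda>\<alpha> g. \<Prod>x\<in>C. g x ^ \<alpha> x"
  have fin: "finite ?B" using C by (simp add: finite_PiE)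
  have card: "card ?B = (D + 1) ^ card C" by (simp add: card_PiE C)
  obtain b where b: "bij_betw b {..<card ?B} ?B"
    using fin by (metis ex_bij_betw_nat_finite lessThan_atLeast0)
  have "\<forall>i\<in>{..<K}. \<exists>a. \<forall>g. e i g = (\<Sum>\<alpha>\<in>?B. a \<alpha> * ?m \<alpha> g)"
    using e unfolding box_poly_def by blast
  then obtain a where a: "\<And>i g. i < K \<Longrightarrow> e i g = (\<Sum>\<alpha>\<in>?B. a i \<alpha> * ?m \<alpha> g)"
    by (metis lessThan_iff)
  obtain c where c: "\<exists>i<K. c i \<noteq> 0" "\<And>j. j < card ?B \<Longrightarrow> (\<Sum>i<K. c i * a i (b j)) = 0"
    using underdetermined_system[of "{..<K}" "card ?B" "\<lambda>i j. a i (b j)"] K card by auto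
  have "(\<Sum>i<K. c i * e i g) = 0" for g
  proof -
    have "(\<Sum>i<K. c i * e i g) = (\<Sum>i<K. \<Sum>j<card ?B. c i * a i (b j) * ?m (b j) g)"
      by (intro sum.cong refl)
        (simp add: a sum.reindex_bij_betw[OF b, symmetric] sum_distrib_left mult.assoc)
    also have "\<dots> = (\<Sum>j<card ?B. (\<Sum>i<K. c i * a i (b j)) * ?m (b j) g)"
      by (subst sum.swap) (simp add: sum_distrib_right)
    finally show ?thesis by (simp add: c)
  qed
  then show ?thesis using c(1) by blast
qed

section \<open>Linear independence modulo the members of a chain of primes\<close>

lemma sum_lessThan_add:
  fixes f :: "nat \<Rightarrow> 'a::comm_monoid_add"
  shows "sum f {..<m + n} = sum f {..<m} + (\<Sum>i<n. f (m + i))"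
  by (induction n) (auto simp: add.assoc)

definition independent_mod :: "('a \<Rightarrow> complex) set \<Rightarrow> nat \<Rightarrow> (nat \<Rightarrow> 'a \<Rightarrow> complex) \<Rightarrow> bool" where
  "independent_mod P K e \<longleftrightarrow> (\<forall>c. (\<lambda>v. \<Sum>i<K. c i * e i v) \<in> P \<longrightarrow> (\<forall>i<K. c i = 0))"

lemma is_ideal_multD: "is_ideal R I \<Longrightarrow> r \<in> R \<Longrightarrow> a \<in> I \<Longrightarrow> (\<lambda>v. r v * a v) \<in> I"
  by (simp add: is_ideal_def)

lemma is_ideal_addD: "is_ideal R I \<Longrightarrow> a \<in> I \<Longrightarrow> b \<in> I \<Longrightarrow> (\<lambda>v. a v + b v) \<in> I"
  by (simp add: is_ideal_def)

lemma is_prime_idealD: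
  "is_prime_ideal R P \<Longrightarrow> a \<in> R \<Longrightarrow> b \<in> R \<Longrightarrow> (\<lambda>v. a v * b v) \<in> P \<Longrightarrow> a \<in> P \<or> b \<in> P"
  by (simp add: is_prime_ideal_def)

text \<open>The unit is a parameter because the members of \<open>inv_ring\<close> are set to zero
  outside \<open>VC\<close>: their unit is the indicator function of \<open>VC\<close>, not the
  constant 1.\<close>

locale function_algebra =
  fixes R :: "('a \<Rightarrow> complex) set" and u :: "'a \<Rightarrow> complex"
  assumes scale_in: "f \<in> R \<Longrightarrow> (\<lambda>v. c * f v) \<in> R"
    and add_in: "f \<in> R \<Longrightarrow> g \<in> R \<Longrightarrow> (\<lambda>v. f v + g v) \<in> R"
    and mult_in: "f \<in> R \<Longrightarrow> g \<in> R \<Longrightarrow> (\<lambda>v. f v * g v) \<in> R"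
    and unit_in: "u \<in> R"
    and unit: "f \<in> R \<Longrightarrow> (\<lambda>v. f v * u v) = f"
begin

lemma zero_in: "(\<lambda>v. 0) \<in> R"
  using scale_in[OF unit_in, of 0] by simp

lemma sum_in: "finite I \<Longrightarrow> (\<And>i. i \<in> I \<Longrightarrow> f i \<in> R) \<Longrightarrow> (\<lambda>v. \<Sum>i\<in>I. f i v) \<in> R"
  by (induction I rule: finite_induct) (auto intro: zero_in add_in)

lemma power_mult_in: "x \<in> R \<Longrightarrow> f \<in> R \<Longrightarrow> (\<lambda>v. x v ^ k * f v) \<in> R"
proof (induction k)
  case (Suc k)
  then show ?case using mult_in[of x "\<lambda>v. x v ^ k * f v"] by (simp add: mult.assoc)
qed simp

text \<open>The new family consists of the products x^a e_b with a < k and b < K, coded as i = a K +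
  b. Modulo Q only the terms with a = 0 survive, so their coefficients vanish. The rest is x t in P,
  and primality gives t in P, a relation with one power of x less.\<close>

lemma independent_mod_step:
  assumes P: "is_prime_ideal R P" and Q: "is_ideal R Q" and PQ: "P \<subseteq> Q"
    and x: "x \<in> Q" "x \<notin> P" and e: "\<And>i. i < K \<Longrightarrow> e i \<in> R" "independent_mod Q K e"
  shows "independent_mod P (k * K) (\<lambda>i v. x v ^ (i div K) * e (i mod K) v)"
  unfolding independent_mod_def
proof (induction k)
  case 0
  then show ?case by simp
next
  case (Suc k)
  have xR: "x \<in> R" using x Q by (auto simp: is_ideal_def)
  have P': "is_ideal R P" using P by (auto simp: is_prime_ideal_def)
  show ?case
  proof (intro allI impI)
    fix c i assume c: "(\<lambda>v. \<Sum>i<Suc k * K. c i * (x v ^ (i div K) * e (i mod K) v)) \<in> P"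
      and i: "i < Suc k * K"
    then have K: "K > 0" by (cases K) auto
    define s where "s = (\<lambda>v. \<Sum>i<K. c i * e i v)"
    define t where "t = (\<lambda>v. \<Sum>i<k * K. c (K + i) * (x v ^ (i div K) * e (i mod K) v))"
    have eq: "(\<Sum>i<Suc k * K. c i * (x v ^ (i div K) * e (i mod K) v)) = s v + x v * t v" for v
      using K by (simp add: sum_lessThan_add s_def t_def sum_distrib_left mult_ac)
    have st: "(\<lambda>v. s v + x v * t v) \<in> P" using c by (simp only: eq)
    have tR: "t \<in> R" unfolding t_def
      using K by (intro sum_in scale_in power_mult_in xR e(1)) auto
    have "(\<lambda>v. t v * x v) \<in> Q" using tR x(1) Q by (auto simp: is_ideal_def)
    then have "(\<lambda>v. - (t v * x v)) \<in> Q" using Q by (auto simp: is_ideal_def)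
    then have "(\<lambda>v. (s v + x v * t v) + - (t v * x v)) \<in> Q"
      by (rule is_ideal_addD[OF Q subsetD[OF PQ st]])
    then have "s \<in> Q" by (simp add: mult.commute)
    then have c0: "c i = 0" if "i < K" for i
      using e(2) that unfolding independent_mod_def s_def by blast
    then have "s = (\<lambda>_. 0)" by (auto simp: s_def)
    then have "(\<lambda>v. x v * t v) \<in> P" using st by simp
    then have "t \<in> P" using is_prime_idealD[OF P xR tR] x(2) by blast
    then have "c (K + i) = 0" if "i < k * K" for i
      using Suc.IH[rule_format, of "\<lambda>i. c (K + i)"] that unfolding t_def by blast
    then show "c i = 0"
      using c0 i by (metis add_diff_inverse_nat add_less_cancel_left mult_Suc)
  qed
qed

text \<open>The step from one prime to the next smaller one is iterated along the chain, starting
  from the unit alone at the top; each step multiplies the number of elements by k. The constant D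
  is chosen before k, so degrees grow only linearly in k.\<close>

lemma chain_independent:
  fixes pt :: "('b \<Rightarrow> complex) \<Rightarrow> 'a"
  assumes C: "finite C" and u: "\<And>g. u (pt g) = 1" and deg: "\<And>f. f \<in> R \<Longrightarrow> \<exists>D. (\<lambda>g. f (pt g)) \<in> box_poly C D"
    and P: "\<And>i. i \<le> n \<Longrightarrow> is_prime_ideal R (P i)" "\<And>i. i < n \<Longrightarrow> P i \<subset> P (Suc i)"
  shows "\<exists>D. \<forall>k. \<exists>e. (\<forall>i<k ^ n. e i \<in> R \<and> (\<lambda>g. e i (pt g)) \<in> box_poly C (n * k * D))
    \<and> independent_mod (P 0) (k ^ n) e"
  using P
proof (induction n arbitrary: P)
  case 0
  \<comment> \<open>A proper ideal contains no nonzero multiple of the unit.\<close>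
  have "independent_mod (P 0) 1 (\<lambda>_. u)"
    unfolding independent_mod_def
  proof (intro allI impI)
    fix c :: "nat \<Rightarrow> complex" and i :: nat
    assume c: "(\<lambda>v. \<Sum>i<1. c i * u v) \<in> P 0" and i: "i < 1"
    have P0: "is_ideal R (P 0)" "P 0 \<noteq> R"
      using 0(1)[of 0] by (auto simp: is_prime_ideal_def)
    show "c i = 0"
    proof (rule ccontr)
      assume "c i \<noteq> 0"
      have "f \<in> P 0" if "f \<in> R" for f
      proof -
        have c0: "c 0 \<noteq> 0" using \<open>c i \<noteq> 0\<close> i by simp
        have "(\<lambda>v. c 0 * u v) \<in> P 0" using c by simp
        then have "(\<lambda>v. (1 / c 0 * f v) * (c 0 * u v)) \<in> P 0"
          by (rule is_ideal_multD[OF P0(1) scale_in[OF that]])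
        moreover have "(\<lambda>v. (1 / c 0 * f v) * (c 0 * u v)) = f"
          using c0 unit[OF that] by simp
        ultimately show ?thesis by simp
      qed
      then show False using P0 by (auto simp: is_ideal_def)
    qed
  qed
  then show ?case
    by (intro exI[of _ 0] allI exI[of _ "\<lambda>_. u"]) (simp add: unit_in u box_poly_const C)
next
  case (Suc n)
  obtain D where D: "\<And>k. \<exists>e. (\<forall>i<k ^ n. e i \<in> R \<and> (\<lambda>g. e i (pt g)) \<in> box_poly C (n * k * D))
    \<and> independent_mod (P 1) (k ^ n) e"
    using Suc.IH[of "\<lambda>i. P (Suc i)"] Suc.prems by auto
  obtain x where x: "x \<in> P 1" "x \<notin> P 0" using Suc.prems(2)[of 0] by auto
  have P1: "is_ideal R (P 1)" "P 0 \<subseteq> P 1"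
    using Suc.prems(1)[of 1] Suc.prems(2)[of 0] by (auto simp: is_prime_ideal_def)
  then have xR: "x \<in> R" using x by (auto simp: is_ideal_def)
  obtain D' where D': "(\<lambda>g. x (pt g)) \<in> box_poly C D'" using deg[OF xR] by blast
  show ?case
  proof (intro exI[of _ "D + D'"] allI)
    fix k
    obtain e where e: "\<And>i. i < k ^ n \<Longrightarrow> e i \<in> R"
      "\<And>i. i < k ^ n \<Longrightarrow> (\<lambda>g. e i (pt g)) \<in> box_poly C (n * k * D)"
      "independent_mod (P 1) (k ^ n) e" using D by blast
    let ?e = "\<lambda>i v. x v ^ (i div k ^ n) * e (i mod k ^ n) v"
    have "independent_mod (P 0) (k ^ Suc n) ?e"
      using independent_mod_step[OF Suc.prems(1) P1 x e(1,3)] by simp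
    moreover have "?e i \<in> R \<and> (\<lambda>g. ?e i (pt g)) \<in> box_poly C (Suc n * k * (D + D'))"
      if "i < k ^ Suc n" for i
    proof
      have k: "k ^ n > 0" using that by (cases k) auto
      then have m: "i mod k ^ n < k ^ n" by simp
      show "?e i \<in> R" by (intro power_mult_in xR e(1) m)
      have "(\<lambda>g. ?e i (pt g)) \<in> box_poly C (i div k ^ n * D' + n * k * D)"
        using m by (intro box_poly_mult box_poly_power C D' e(2))
      moreover have "i div k ^ n * D' + n * k * D \<le> Suc n * k * (D + D')"
      proof -
        have "i div k ^ n \<le> k" using that k by (simp add: less_mult_imp_div_less less_imp_le)
        then have "i div k ^ n * D' \<le> k * D'" by (rule mult_le_mono1)
        then show ?thesis by (rule order_trans[OF add_mono[OF _ order_refl]]) (simp add: algebra_simps)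
      qed
      ultimately show "(\<lambda>g. ?e i (pt g)) \<in> box_poly C (Suc n * k * (D + D'))"
        using box_poly_mono[OF C] by blast
    qed
    ultimately show "\<exists>e. (\<forall>i<k ^ Suc n. e i \<in> R \<and> (\<lambda>g. e i (pt g)) \<in> box_poly C (Suc n * k * (D + D')))
        \<and> independent_mod (P 0) (k ^ Suc n) e" by (intro exI[of _ ?e]) blast
  qed
qed

text \<open>Here \<open>pt\<close> parametrises a subset on which elements of R are polynomials in
  card C variables and, by injectivity, are determined. A chain longer than card C would give more
  independent elements than there are monomials available.\<close>

lemma chain_length_le:
  fixes pt :: "('b \<Rightarrow> complex) \<Rightarrow> 'a"
  assumes C: "finite C" and u: "\<And>g. u (pt g) = 1" and deg: "\<And>f. f \<in> R \<Longrightarrow> \<exists>D. (\<lambda>g. f (pt g)) \<in> box_poly C D"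
    and inj: "\<And>f. f \<in> R \<Longrightarrow> (\<And>g. f (pt g) = 0) \<Longrightarrow> f = (\<lambda>_. 0)"
    and P: "\<And>i. i \<le> n \<Longrightarrow> is_prime_ideal R (P i)" "\<And>i. i < n \<Longrightarrow> P i \<subset> P (Suc i)"
  shows "n \<le> card C"
proof (rule ccontr)
  assume "\<not> n \<le> card C"
  define d where "d = card C"
  have n: "Suc d \<le> n" using \<open>\<not> n \<le> card C\<close> by (simp add: d_def)
  obtain D where D: "\<And>k. \<exists>e. (\<forall>i<k ^ n. e i \<in> R \<and> (\<lambda>g. e i (pt g)) \<in> box_poly C (n * k * D))
    \<and> independent_mod (P 0) (k ^ n) e"
    using chain_independent[where n = n and P = P and pt = pt, OF C u deg P] by blast
  \<comment> \<open>With this k, (n k D + 1)^d is at most (n D + 1)^d k^d, which is below k^(d+1),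
    hence below k^n.\<close>
  obtain k where k: "(n * D + 1) ^ d < k" "1 \<le> k"
    using that[of "(n * D + 1) ^ d + 1"] by simp
  obtain e where e: "\<And>i. i < k ^ n \<Longrightarrow> e i \<in> R"
    "\<And>i. i < k ^ n \<Longrightarrow> (\<lambda>g. e i (pt g)) \<in> box_poly C (n * k * D)"
    "independent_mod (P 0) (k ^ n) e" using D by blast
  have "(n * k * D + 1) ^ d \<le> ((n * D + 1) * k) ^ d"
    using k(2) by (intro power_mono) (auto simp: algebra_simps)
  also have "\<dots> < k * k ^ d"
    unfolding power_mult_distrib using k by (intro mult_strict_right_mono) auto
  also have "\<dots> \<le> k ^ n"
    using power_increasing[OF n k(2)] by simp
  finally have "(n * k * D + 1) ^ card C < k ^ n" by (simp only: d_def)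
  then have "\<exists>c. (\<exists>i<k ^ n. c i \<noteq> 0) \<and> (\<forall>g. (\<Sum>i<k ^ n. c i * e i (pt g)) = 0)"
    by (rule box_poly_dependent[where e = "\<lambda>i g. e i (pt g)", OF C e(2), rotated])
  then obtain c where c': "(\<exists>i<k ^ n. c i \<noteq> 0) \<and> (\<forall>g. (\<Sum>i<k ^ n. c i * e i (pt g)) = 0)" ..
  note c = conjunct1[OF c'] conjunct2[OF c']
  have "(\<lambda>v. \<Sum>i<k ^ n. c i * e i v) \<in> R"
    by (rule sum_in, simp) (rule scale_in[OF e(1)], simp)
  from inj[OF this c(2)[rule_format]] have "(\<lambda>v. \<Sum>i<k ^ n. c i * e i v) = (\<lambda>_. 0)" .
  moreover have "(\<lambda>_. 0) \<in> P 0" using P(1)[of 0] by (simp add: is_prime_ideal_def is_ideal_def)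
  ultimately have "(\<lambda>v. \<Sum>i<k ^ n. c i * e i v) \<in> P 0" by simp
  then show False using e(3) c(1) unfolding independent_mod_def by blast
qed

end

section \<open>Covariants and invariants\<close>

lemma polyfun_sum: "(\<And>i. i \<in> I \<Longrightarrow> f i \<in> polyfun) \<Longrightarrow> (\<lambda>v. \<Sum>i\<in>I. f i v) \<in> polyfun"
  by (induction I rule: infinite_finite_induct) (auto intro: polyfun.intros)

lemma polyfun_prod: "(\<And>i. i \<in> I \<Longrightarrow> f i \<in> polyfun) \<Longrightarrow> (\<lambda>v. \<Prod>i\<in>I. f i v) \<in> polyfun"
  by (induction I rule: infinite_finite_induct) (auto intro: polyfun.intros)

text \<open>Reduces arguments about several variables to one-variable polynomials; both the Zariski
  density of the real form and the primality of the vanishing ideals rest on it.\<close>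

lemma polyfun_line:
  assumes "p \<in> polyfun"
  shows "\<exists>P. \<forall>t. p (\<lambda>x. a x + t * b x) = poly P t"
  using assms
proof induction
  case (const c)
  show ?case by (rule exI[of _ "[:c:]"]) simp
next
  case (coord x)
  show ?case by (rule exI[of _ "[:a x, b x:]"]) simp
next
  case (add f g)
  then obtain P Q where "\<forall>t. f (\<lambda>x. a x + t * b x) = poly P t" "\<forall>t. g (\<lambda>x. a x + t * b x) = poly Q t"
    by blast
  then show ?case by (intro exI[of _ "P + Q"]) simp
next
  case (mult f g)
  then obtain P Q where "\<forall>t. f (\<lambda>x. a x + t * b x) = poly P t" "\<forall>t. g (\<lambda>x. a x + t * b x) = poly Q t"
    by blast
  then show ?case by (intro exI[of _ "P * Q"]) simp
qed

lemma sum_swap_pairs: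
  "(\<Sum>k\<in>K. \<Sum>l\<in>L. \<Sum>a\<in>A. \<Sum>b\<in>B. f k l a b) = (\<Sum>a\<in>A. \<Sum>b\<in>B. \<Sum>k\<in>K. \<Sum>l\<in>L. f k l a b)"
  for f :: "_ \<Rightarrow> _ \<Rightarrow> _ \<Rightarrow> _ \<Rightarrow> 'z::comm_monoid_add"
proof -
  have "(\<Sum>k\<in>K. \<Sum>l\<in>L. \<Sum>a\<in>A. \<Sum>b\<in>B. f k l a b) = (\<Sum>k\<in>K. \<Sum>a\<in>A. \<Sum>b\<in>B. \<Sum>l\<in>L. f k l a b)"
    by (intro sum.cong refl, subst sum.swap, intro sum.cong refl sum.swap)
  also have "\<dots> = (\<Sum>a\<in>A. \<Sum>k\<in>K. \<Sum>b\<in>B. \<Sum>l\<in>L. f k l a b)" by (rule sum.swap)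
  also have "\<dots> = (\<Sum>a\<in>A. \<Sum>b\<in>B. \<Sum>k\<in>K. \<Sum>l\<in>L. f k l a b)"
    by (intro sum.cong refl sum.swap)
  finally show ?thesis .
qed

lemma SU_unitary: "U \<in> SU N \<Longrightarrow> unitary N U"
  by (auto simp: SU_def unitary_def mm_def adj_def)

lemma act_Mu: "act N U v (Mu i j) = mm N U (mm N (\<lambda>a b. v (Mu a b)) (adj U)) i j"
  by (simp add: act_def mm_def adj_def sum_distrib_left mult_ac)

text \<open>Equivariant polynomial maps from V_C to N x N matrices, on which SU(N) acts by
  conjugation. They form an algebra, and traces and determinants turn them into invariants.\<close>

definition covariant :: "nat \<Rightarrow> (point \<Rightarrow> nat \<Rightarrow> nat \<Rightarrow> complex) \<Rightarrow> bool" where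
  "covariant N F \<longleftrightarrow> (\<forall>i j. (\<lambda>v. F v i j) \<in> polyfun) \<and>
     (\<forall>U\<in>SU N. \<forall>v\<in>VC N. \<forall>i<N. \<forall>j<N. F (act N U v) i j = mm N U (mm N (F v) (adj U)) i j)"

lemma covariantD:
  assumes "covariant N F" "U \<in> SU N" "v \<in> VC N" "i < N" "j < N"
  shows "F (act N U v) i j = mm N U (mm N (F v) (adj U)) i j"
  using assms by (simp add: covariant_def)

lemma covariant_polyfun: "covariant N F \<Longrightarrow> (\<lambda>v. F v i j) \<in> polyfun"
  by (simp add: covariant_def)

lemma covariant_Mu: "covariant N (\<lambda>v i j. v (Mu i j))"
  unfolding covariant_def using act_Mu by (auto intro: polyfun.coord)

lemma covariant_one: "covariant N (\<lambda>v i j. if i = j then 1 else 0)"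
  unfolding covariant_def
proof (intro conjI allI ballI impI)
  fix U v i j assume U: "U \<in> SU N" and ij: "i < N" "j < N"
  have "mm N U (mm N (\<lambda>i j. if i = j then 1 else 0) (adj U)) i j = mm N U (adj U) i j"
    by (intro mm_cong refl mm_one_left) auto
  then show "(if i = j then 1 else 0) = mm N U (mm N (\<lambda>i j. if i = j then 1 else 0) (adj U)) i j"
    using SU_unitary[OF U] ij by (simp add: unitary_def)
qed (auto intro: polyfun.const)

lemma covariant_mm:
  assumes "covariant N F" "covariant N G"
  shows "covariant N (\<lambda>v. mm N (F v) (G v))"
  unfolding covariant_def
proof (intro conjI allI ballI impI)
  fix i j
  show "(\<lambda>v. mm N (F v) (G v) i j) \<in> polyfun"
    unfolding mm_def using assms by (intro polyfun_sum polyfun.mult covariant_polyfun)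
next
  fix U v i j assume U: "U \<in> SU N" and v: "v \<in> VC N" and ij: "i < N" "j < N"
  have "mm N (F (act N U v)) (G (act N U v)) i j
      = mm N (mm N U (mm N (F v) (adj U))) (mm N U (mm N (G v) (adj U))) i j"
    using assms U v ij by (intro mm_cong covariantD)
  also have "\<dots> = mm N U (mm N (F v) (mm N (mm N (adj U) U) (mm N (G v) (adj U)))) i j"
    by (simp add: mm_assoc)
  also have "\<dots> = mm N U (mm N (F v) (mm N (G v) (adj U))) i j"
    using unitary_adj[OF SU_unitary[OF U]] by (intro mm_cong refl mm_one_left) auto
  finally show "mm N (F (act N U v)) (G (act N U v)) i j = mm N U (mm N (mm N (F v) (G v)) (adj U)) i j"
    by (simp add: mm_assoc)
qed

lemma covariant_lincomb:
  assumes "covariant N F" "covariant N G"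
  shows "covariant N (\<lambda>v i j. c * F v i j + d * G v i j)"
  unfolding covariant_def
proof (intro conjI allI ballI impI)
  fix i j
  show "(\<lambda>v. c * F v i j + d * G v i j) \<in> polyfun"
    using assms by (intro polyfun.add polyfun.mult polyfun.const covariant_polyfun)
next
  fix U v i j assume "U \<in> SU N" "v \<in> VC N" "i < N" "j < N"
  then show "c * F (act N U v) i j + d * G (act N U v) i j
     = mm N U (mm N (\<lambda>i j. c * F v i j + d * G v i j) (adj U)) i j"
    by (simp add: covariantD[OF assms(1)] covariantD[OF assms(2)])
      (simp add: mm_def algebra_simps sum_distrib_left sum.distrib)
qed

text \<open>The tensor z as a linear operator on matrices. The indices of \<open>A\<close> are
  transposed because k transforms with U and l with its conjugate.\<close>

definition contr :: "nat \<Rightarrow> point \<Rightarrow> (nat \<Rightarrow> nat \<Rightarrow> complex) \<Rightarrow> nat \<Rightarrow> nat \<Rightarrow> complex" where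
  "contr N v A = (\<lambda>i j. \<Sum>k<N. \<Sum>l<N. v (Z i j k l) * A l k)"

lemma covariant_contr:
  assumes "covariant N F"
  shows "covariant N (\<lambda>v. contr N v (F v))"
  unfolding covariant_def
proof (intro conjI allI ballI impI)
  fix i j
  show "(\<lambda>v. contr N v (F v) i j) \<in> polyfun"
    unfolding contr_def using assms by (intro polyfun_sum polyfun.mult polyfun.coord covariant_polyfun)
next
  fix U v i j assume U: "U \<in> SU N" and v: "v \<in> VC N" and ij: "i < N" "j < N"
  let ?A = "F v" and ?A' = "mm N U (mm N (F v) (adj U))"
  \<comment> \<open>The factors U from the second index pair of z undo the conjugation of
    \<open>F v\<close>.\<close>
  have inner: "(\<Sum>k<N. \<Sum>l<N. U k c * cnj (U l d) * ?A' l k) = ?A d c" if "c < N" "d < N" for c d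
  proof -
    have "(\<Sum>k<N. \<Sum>l<N. U k c * cnj (U l d) * ?A' l k) = (\<Sum>l<N. \<Sum>k<N. adj U d l * (?A' l k * U k c))"
      by (subst sum.swap) (simp add: adj_def mult_ac)
    also have "\<dots> = mm N (adj U) (mm N ?A' U) d c" by (simp add: mm_def sum_distrib_left)
    also have "\<dots> = mm N (mm N (adj U) U) (mm N ?A (mm N (adj U) U)) d c" by (simp add: mm_assoc)
    also have "\<dots> = mm N ?A (mm N (adj U) U) d c"
      using that unitary_adj[OF SU_unitary[OF U]] by (intro mm_one_left) auto
    also have "\<dots> = ?A d c"
      using that unitary_adj[OF SU_unitary[OF U]] by (intro mm_one_right) auto
    finally show ?thesis .
  qed
  have "contr N (act N U v) (F (act N U v)) i j
     = (\<Sum>k<N. \<Sum>l<N. act N U v (Z i j k l) * ?A' l k)"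
    unfolding contr_def using covariantD[OF assms U v] by (intro sum.cong refl) auto
  also have "\<dots> = (\<Sum>k<N. \<Sum>l<N. \<Sum>a<N. \<Sum>b<N. U i a * cnj (U j b) *
      (\<Sum>c<N. \<Sum>d<N. v (Z a b c d) * (U k c * cnj (U l d) * ?A' l k)))"
    by (simp add: act_def sum_distrib_left sum_distrib_right mult_ac)
  also have "\<dots> = (\<Sum>a<N. \<Sum>b<N. U i a * cnj (U j b) *
      (\<Sum>k<N. \<Sum>l<N. \<Sum>c<N. \<Sum>d<N. v (Z a b c d) * (U k c * cnj (U l d) * ?A' l k)))"
    by (subst sum_swap_pairs) (simp only: sum_distrib_left)
  also have "\<dots> = (\<Sum>a<N. \<Sum>b<N. U i a * cnj (U j b) *
      (\<Sum>c<N. \<Sum>d<N. v (Z a b c d) * (\<Sum>k<N. \<Sum>l<N. U k c * cnj (U l d) * ?A' l k)))"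
    by (subst sum_swap_pairs) (simp only: sum_distrib_left)
  also have "\<dots> = (\<Sum>a<N. \<Sum>b<N. U i a * cnj (U j b) * contr N v ?A a b)"
    unfolding contr_def by (intro sum.cong refl arg_cong2[where f = "(*)"]) (simp only: lessThan_iff inner)
  also have "\<dots> = mm N U (mm N (contr N v ?A) (adj U)) i j"
    by (simp add: mm_def adj_def sum_distrib_left mult_ac)
  finally show "contr N (act N U v) (F (act N U v)) i j = mm N U (mm N (contr N v ?A) (adj U)) i j" .
qed

section \<open>Invariants from traces and determinants\<close>

definition invariant :: "nat \<Rightarrow> (point \<Rightarrow> complex) \<Rightarrow> bool" where
  "invariant N f \<longleftrightarrow> f \<in> polyfun \<and> (\<forall>U\<in>SU N. \<forall>v\<in>VC N. f (act N U v) = f v)"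

lemma invariant_trace:
  assumes "covariant N F"
  shows "invariant N (\<lambda>v. \<Sum>i<N. F v i i)"
  unfolding invariant_def
proof (intro conjI ballI)
  show "(\<lambda>v. \<Sum>i<N. F v i i) \<in> polyfun"
    using assms by (intro polyfun_sum covariant_polyfun)
  fix U v assume U: "U \<in> SU N" and v: "v \<in> VC N"
  have "(\<Sum>i<N. F (act N U v) i i) = (\<Sum>i<N. \<Sum>k<N. \<Sum>l<N. U i k * F v k l * adj U l i)"
    using covariantD[OF assms U v] by (simp add: mm_def sum_distrib_left mult_ac)
  also have "\<dots> = (\<Sum>k<N. \<Sum>i<N. \<Sum>l<N. U i k * F v k l * adj U l i)" by (rule sum.swap)
  also have "\<dots> = (\<Sum>k<N. mm N (F v) (mm N (adj U) U) k k)"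
    by (intro sum.cong refl, subst sum.swap) (simp add: mm_def sum_distrib_left mult_ac)
  also have "\<dots> = (\<Sum>k<N. F v k k)"
    using unitary_adj[OF SU_unitary[OF U]] by (intro sum.cong refl mm_one_right) auto
  finally show "(\<Sum>i<N. F (act N U v) i i) = (\<Sum>i<N. F v i i)" .
qed

lemma mat_mm: "mat N N (\<lambda>(i, j). mm N A B i j) = mat N N (\<lambda>(i, j). A i j) * mat N N (\<lambda>(i, j). B i j)"
  by (intro eq_matI) (auto simp: mm_def scalar_prod_def lessThan_atLeast0)

lemma det_mm: "det (mat N N (\<lambda>(i, j). mm N A B i j))
    = det (mat N N (\<lambda>(i, j). A i j)) * det (mat N N (\<lambda>(i, j). B i j))"
  unfolding mat_mm by (rule det_mult) auto

lemma det_mat_cong: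
  "(\<And>i j. i < N \<Longrightarrow> j < N \<Longrightarrow> A i j = B i j) \<Longrightarrow> det (mat N N (\<lambda>(i, j). A i j)) = det (mat N N (\<lambda>(i, j). B i j))"
  by (rule arg_cong[of _ _ det], rule eq_matI) auto

lemma det_unitary:
  assumes "unitary N U"
  shows "det (mat N N (\<lambda>(i, j). U i j)) * det (mat N N (\<lambda>(i, j). adj U i j)) = 1"
proof -
  have "mat N N (\<lambda>(i, j). mm N U (adj U) i j) = 1\<^sub>m N"
    using assms by (intro eq_matI) (auto simp: unitary_def)
  then show ?thesis using det_mm[of N U "adj U"] by simp
qed

lemma invariant_det:
  assumes "covariant N F"
  shows "invariant N (\<lambda>v. det (mat N N (\<lambda>(i, j). F v i j)))"
  unfolding invariant_def
proof (intro conjI ballI)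
  have "det (mat N N (\<lambda>(i, j). F v i j))
      = (\<Sum>p | p permutes {0..<N}. signof p * (\<Prod>i = 0..<N. F v i (p i)))" for v
    by (subst det_def'[of _ N], simp, intro sum.cong refl arg_cong2[where f = "(*)"] prod.cong)
      (auto simp: permutes_in_image)
  then show "(\<lambda>v. det (mat N N (\<lambda>(i, j). F v i j))) \<in> polyfun"
    using assms by (simp only:) (intro polyfun_sum polyfun_prod polyfun.mult polyfun.const covariant_polyfun)
  fix U v assume U: "U \<in> SU N" and v: "v \<in> VC N"
  have "det (mat N N (\<lambda>(i, j). F (act N U v) i j)) = det (mat N N (\<lambda>(i, j). mm N U (mm N (F v) (adj U)) i j))"
    using covariantD[OF assms U v] by (intro det_mat_cong)
  also have "\<dots> = det (mat N N (\<lambda>(i, j). F v i j))"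
    using det_unitary[OF SU_unitary[OF U]] by (simp only: det_mm mult_ac) simp
  finally show "det (mat N N (\<lambda>(i, j). F (act N U v) i j)) = det (mat N N (\<lambda>(i, j). F v i j))" .
qed

lemma invariant_const: "invariant N (\<lambda>v. c)"
  by (simp add: invariant_def polyfun.const)

lemma invariant_add: "invariant N f \<Longrightarrow> invariant N g \<Longrightarrow> invariant N (\<lambda>v. f v + g v)"
  by (simp add: invariant_def polyfun.add)

lemma invariant_mult: "invariant N f \<Longrightarrow> invariant N g \<Longrightarrow> invariant N (\<lambda>v. f v * g v)"
  by (simp add: invariant_def polyfun.mult)

section \<open>Matrix units at points with mu = diag(0, ..., N-1)\<close>

definition diag_base :: "nat \<Rightarrow> point \<Rightarrow> bool" where
  "diag_base N v \<longleftrightarrow> (\<forall>a<N. \<forall>b<N. v (Mu a b) = (if a = b then of_nat a else 0))"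

text \<open>The Lagrange polynomial of the node i among 0, ..., N-1, evaluated at the matrix mu, is
  covariant everywhere; where mu = diag(0, ..., N-1) it is the projector onto the i-th coordinate.
  The product over the nodes is built up factor by factor.\<close>

lemma projector_exists:
  "\<exists>E. covariant N E \<and> (\<forall>v. diag_base N v \<longrightarrow>
     (\<forall>a<N. \<forall>b<N. E v a b = (if a = i \<and> b = i then 1 else 0)))"
proof -
  have "\<exists>E. covariant N E \<and> (\<forall>v. diag_base N v \<longrightarrow> (\<forall>a<N. \<forall>b<N. E v a b
       = (if a = b then (\<Prod>j\<in>J. (of_nat a - of_nat j) / (of_nat i - of_nat j)) else 0)))" if "finite J" for J
    using that
  proof (induction J)
    case empty
    show ?case by (intro exI[of _ "\<lambda>v i j. if i = j then 1 else 0"]) (simp add: covariant_one)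
  next
    case (insert j J)
    then obtain E where E: "covariant N E" "\<And>v a b. diag_base N v \<Longrightarrow> a < N \<Longrightarrow> b < N \<Longrightarrow>
      E v a b = (if a = b then (\<Prod>j\<in>J. (of_nat a - of_nat j) / (of_nat i - of_nat j)) else 0)"
      by blast
    let ?c = "1 / (of_nat i - of_nat j) :: complex"
    let ?G = "\<lambda>v a b. ?c * v (Mu a b) + (- of_nat j * ?c) * (if a = b then 1 else 0)"
    show ?case
    proof (intro exI[of _ "\<lambda>v. mm N (?G v) (E v)"] conjI allI impI)
      show "covariant N (\<lambda>v. mm N (?G v) (E v))"
        by (intro covariant_mm covariant_lincomb covariant_Mu covariant_one E(1))
    next
      fix v a b assume v: "diag_base N v" and ab: "a < N" "b < N"
      have "mm N (?G v) (E v) a b = (\<Sum>k<N. if k = a then (of_nat a - of_nat j) / (of_nat i - of_nat j) * E v a b else 0)"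
        unfolding mm_def using v ab by (intro sum.cong) (auto simp: diag_base_def diff_divide_distrib)
      then show "mm N (?G v) (E v) a b = (if a = b then (\<Prod>j\<in>insert j J. (of_nat a - of_nat j) / (of_nat i - of_nat j)) else 0)"
        using ab E(2)[OF v] insert.hyps by simp
    qed
  qed
  from this[of "{..<N} - {i}"] obtain E where E: "covariant N E" "\<And>v a b. diag_base N v \<Longrightarrow> a < N \<Longrightarrow> b < N \<Longrightarrow>
      E v a b = (if a = b then (\<Prod>j\<in>{..<N} - {i}. (of_nat a - of_nat j) / (of_nat i - of_nat j)) else 0)"
    by blast
  \<comment> \<open>For a different from i the factor with j = a vanishes; for a = i all factors are
    1.\<close>
  have "(\<Prod>j\<in>{..<N} - {i}. (of_nat a - of_nat j) / (of_nat i - of_nat j)) = (if a = i then 1 else 0 :: complex)"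
    if "a < N" for a
    using that by (auto intro!: prod.neutral)
  then show ?thesis using E by (intro exI[of _ E]) auto
qed

lemma mm_unit_left:
  assumes "i < N" "a < N" "\<And>b. b < N \<Longrightarrow> E a b = (if a = i \<and> b = i then 1 else 0)"
  shows "mm N E A a b = (if a = i then A i b else 0)"
proof -
  have "mm N E A a b = (\<Sum>k<N. if k = i then (if a = i then A i b else 0) else 0)"
    unfolding mm_def using assms(3) by (intro sum.cong) auto
  then show ?thesis using assms(1) by simp
qed

lemma mm_unit_right:
  assumes "i < N" "b < N" "\<And>a. a < N \<Longrightarrow> E a b = (if a = i \<and> b = i then 1 else 0)"
  shows "mm N A E a b = (if b = i then A a i else 0)"
proof -
  have "mm N A E a b = (\<Sum>k<N. if k = i then (if b = i then A a i else 0) else 0)"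
    unfolding mm_def using assms(3) by (intro sum.cong) auto
  then show ?thesis using assms(1) by simp
qed

text \<open>A rank-one projector in the middle decouples the two outer matrices, so that single
  entries can be multiplied.\<close>

lemma mm_unit_middle:
  assumes "i < N" "\<And>a b. a < N \<Longrightarrow> b < N \<Longrightarrow> E a b = (if a = i \<and> b = i then 1 else 0)"
  shows "mm N A (mm N E B) a b = A a i * B i b"
proof -
  have "mm N A (mm N E B) a b = (\<Sum>k<N. if k = i then A a i * B i b else 0)"
    unfolding mm_def[of N A] using assms by (intro sum.cong) (auto simp: mm_unit_left[of i N _ E])
  then show ?thesis using assms(1) by simp
qed

lemma contr_unit:
  assumes "k < N" "l < N" "\<And>a b. a < N \<Longrightarrow> b < N \<Longrightarrow> A a b = (if a = l \<and> b = k then 1 else 0)"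
  shows "contr N v A i j = v (Z i j k l)"
proof -
  have "contr N v A i j = (\<Sum>k'<N. \<Sum>l'<N. if l' = l then (if k' = k then v (Z i j k l) else 0) else 0)"
    unfolding contr_def using assms(3) by (intro sum.cong refl) auto
  then show ?thesis using assms(1,2) by simp
qed

section \<open>The slice\<close>

definition zrep :: "nat \<Rightarrow> nat \<Rightarrow> nat \<Rightarrow> nat \<Rightarrow> idx" where
  "zrep i j k l = (if i < k \<or> i = k \<and> j \<le> l then Z i j k l else Z k l i j)"

text \<open>zrep picks one of the two equal entries z_ij,kl = z_kl,ij; gauge merges z_00,k0 into z_00,0k.\<close>

definition gauge :: "idx \<Rightarrow> idx" where
  "gauge x = (case x of Mu i j \<Rightarrow> Mu i j
     | Z i j k l \<Rightarrow> if i = 0 \<and> j = 0 \<and> l = 0 then Z 0 0 0 k else Z i j k l)"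

text \<open>A parametrisation of S that is linear in g and takes every g: all entries with the same
  symmetrised and gauged index read the same value, and only the values of g on
  \<open>coords N\<close> enter.\<close>

definition slice :: "nat \<Rightarrow> (idx \<Rightarrow> complex) \<Rightarrow> point" where
  "slice N g = (\<lambda>x. case x of
      Mu i j \<Rightarrow> if i = j \<and> i < N then g (Mu i i) else 0
    | Z i j k l \<Rightarrow> if i < N \<and> j < N \<and> k < N \<and> l < N then g (gauge (zrep i j k l)) else 0)"

definition eig_coords :: "nat \<Rightarrow> idx set" where
  "eig_coords N = (\<lambda>i. Mu i i) ` {..<N}"

text \<open>The entries made real by diagonal phases. Index 0 is left out, since z_(00,00) is
  unchanged by such phases; it counts as free.\<close>

definition phase_coords :: "nat \<Rightarrow> idx set" where
  "phase_coords N = (\<lambda>i. Z 0 0 0 i) ` {1..<N}"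

definition quartic_coords :: "nat \<Rightarrow> idx set" where
  "quartic_coords N = {zrep i j k l |i j k l. i < N \<and> j < N \<and> k < N \<and> l < N}"

definition free_coords :: "nat \<Rightarrow> idx set" where
  "free_coords N = quartic_coords N - phase_coords N - (\<lambda>k. Z 0 0 k 0) ` {1..<N}"

definition coords :: "nat \<Rightarrow> idx set" where
  "coords N = free_coords N \<union> phase_coords N \<union> eig_coords N"

lemma zrep_swap: "zrep i j k l = zrep k l i j"
  by (auto simp: zrep_def)

lemma phase_subset: "phase_coords N \<subseteq> quartic_coords N"
proof
  fix x assume "x \<in> phase_coords N"
  then obtain i where "1 \<le> i" "i < N" "x = Z 0 0 0 i" by (auto simp: phase_coords_def)
  then show "x \<in> quartic_coords N" unfolding quartic_coords_def zrep_def
    by (intro CollectI exI[of _ 0] exI[of _ i]) auto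
qed

text \<open>Among the representatives, \<open>gauge\<close> moves only \<open>Z 0 0 m 0\<close> with
  m at least 1, and sends it to a phase coordinate.\<close>

lemma gauge_in_coords:
  assumes "i < N" "j < N" "k < N" "l < N"
  shows "gauge (zrep i j k l) \<in> coords N"
proof (cases "\<exists>m. m \<ge> 1 \<and> m < N \<and> zrep i j k l = Z 0 0 m 0")
  case True
  then show ?thesis by (auto simp: gauge_def coords_def phase_coords_def)
next
  case False
  have "gauge (zrep i j k l) = zrep i j k l"
  proof (cases "zrep i j k l")
    case (Z a b c d)
    have "c < N" using Z assms by (auto simp: zrep_def split: if_splits)
    then show ?thesis using False Z by (cases c) (auto simp: gauge_def)
  qed (simp add: gauge_def)
  moreover have "zrep i j k l \<in> quartic_coords N" using assms by (auto simp: quartic_coords_def)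
  ultimately show ?thesis using False by (auto simp: coords_def free_coords_def)
qed

section \<open>Counting the coordinates of the slice\<close>

lemma finite_quartic: "finite (quartic_coords N)"
proof -
  have "quartic_coords N \<subseteq> (\<lambda>(i, j, k, l). Z i j k l) ` ({..<N} \<times> {..<N} \<times> {..<N} \<times> {..<N})"
    by (auto simp: quartic_coords_def zrep_def image_iff)
  then show ?thesis by (rule finite_subset) auto
qed

text \<open>Representatives correspond to lexicographically ordered pairs of index pairs. These and
  the reversely ordered ones are equinumerous, cover all N^4 pairs, and overlap in the N^2 diagonal
  ones.\<close>

lemma card_quartic: "2 * card (quartic_coords N) = N\<^sup>2 * (N\<^sup>2 + 1)"
proof -
  let ?A = "{..<N} \<times> {..<N}"
  let ?L = "{(x, y) \<in> ?A \<times> ?A. fst x < fst y \<or> fst x = fst y \<and> snd x \<le> snd y}"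
  let ?G = "{(x, y) \<in> ?A \<times> ?A. fst y < fst x \<or> fst y = fst x \<and> snd y \<le> snd x}"
  have fin: "finite ?L" "finite ?G" by (rule finite_subset[of _ "?A \<times> ?A"]; auto)+
  have "bij_betw (\<lambda>((i, j), (k, l)). Z i j k l) ?L (quartic_coords N)"
    unfolding bij_betw_def
  proof
    show "inj_on (\<lambda>((i, j), (k, l)). Z i j k l) ?L" by (auto simp: inj_on_def)
    show "(\<lambda>((i, j), (k, l)). Z i j k l) ` ?L = quartic_coords N"
    proof
      show "(\<lambda>((i, j), (k, l)). Z i j k l) ` ?L \<subseteq> quartic_coords N"
      proof
        fix x assume "x \<in> (\<lambda>((i, j), (k, l)). Z i j k l) ` ?L"
        then obtain i j k l where "i < N" "j < N" "k < N" "l < N" "i < k \<or> i = k \<and> j \<le> l" "x = Z i j k l"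
          by auto
        then show "x \<in> quartic_coords N" unfolding quartic_coords_def
          by (intro CollectI exI[of _ i] exI[of _ j] exI[of _ k] exI[of _ l]) (auto simp: zrep_def)
      qed
      show "quartic_coords N \<subseteq> (\<lambda>((i, j), (k, l)). Z i j k l) ` ?L"
      proof
        fix x assume "x \<in> quartic_coords N"
        then obtain i j k l where ijkl: "i < N" "j < N" "k < N" "l < N" "x = zrep i j k l"
          by (auto simp: quartic_coords_def)
        show "x \<in> (\<lambda>((i, j), (k, l)). Z i j k l) ` ?L"
        proof (cases "i < k \<or> i = k \<and> j \<le> l")
          case True
          then show ?thesis using ijkl by (intro image_eqI[of _ _ "((i, j), (k, l))"]) (auto simp: zrep_def)
        next
          case False
          then show ?thesis using ijkl by (intro image_eqI[of _ _ "((k, l), (i, j))"]) (auto simp: zrep_def)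
        qed
      qed
    qed
  qed
  then have 1: "card (quartic_coords N) = card ?L" by (simp add: bij_betw_same_card)
  have "bij_betw prod.swap ?L ?G"
    by (rule bij_betw_byWitness[of _ prod.swap]) auto
  then have 2: "card ?G = card ?L" by (simp add: bij_betw_same_card)
  have "?L \<union> ?G = ?A \<times> ?A" by auto
  moreover have "?L \<inter> ?G = (\<lambda>x. (x, x)) ` ?A" by auto
  moreover have "card ((\<lambda>x. (x, x)) ` ?A) = card ?A" by (intro card_image) (auto simp: inj_on_def)
  ultimately have "card ?L + card ?G = card (?A \<times> ?A) + card ?A"
    using card_Un_Int[OF fin] by simp
  then show ?thesis unfolding 1 2 by (simp add: card_cartesian_product power2_eq_square algebra_simps)
qed

lemma finite_coords: "finite (coords N)"
  unfolding coords_def free_coords_def using finite_quartic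
  by (auto simp: phase_coords_def eig_coords_def)

text \<open>Merging z_(00,k0) into z_(00,0k) removes N - 1 of the N^2 (N^2 + 1) / 2 quartic
  coordinates, and the eigenvalues add N: a net gain of one.\<close>

lemma card_coords:
  assumes "1 \<le> N"
  shows "card (coords N) = (N^4 + N^2 + 2) div 2"
proof -
  let ?K = "(\<lambda>k. Z 0 0 k 0) ` {1..<N}"
  have K: "?K \<subseteq> quartic_coords N"
  proof
    fix x assume "x \<in> ?K"
    then obtain k where k: "1 \<le> k" "k < N" "x = Z 0 0 k 0" by auto
    then have "x = zrep 0 0 k 0" by (simp add: zrep_def)
    then show "x \<in> quartic_coords N" unfolding quartic_coords_def using k
      by (intro CollectI exI[of _ 0] exI[of _ k]) auto
  qed
  have "coords N = (quartic_coords N - ?K) \<union> eig_coords N"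
    using phase_subset[of N] by (auto simp: coords_def free_coords_def phase_coords_def)
  moreover have "(quartic_coords N - ?K) \<inter> eig_coords N = {}"
    by (auto simp: quartic_coords_def eig_coords_def zrep_def split: if_splits)
  moreover have "card (eig_coords N) = N" unfolding eig_coords_def
    by (subst card_image) (auto simp: inj_on_def)
  moreover have "card ?K = N - 1" by (subst card_image) (auto simp: inj_on_def)
  ultimately have "card (coords N) = card (quartic_coords N) - (N - 1) + N"
    using K finite_quartic[of N] by (simp add: card_Un_disjoint card_Diff_subset finite_subset eig_coords_def)
  moreover have "N - 1 \<le> card (quartic_coords N)"
    using card_mono[OF finite_quartic K] \<open>card ?K = N - 1\<close> by simp
  ultimately have "2 * card (coords N) = 2 * card (quartic_coords N) + 2"
    using assms by simp
  also have "\<dots> = N^4 + N^2 + 2"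
    unfolding card_quartic by (simp add: algebra_simps power_numeral_reduce)
  finally show ?thesis by simp
qed

lemma slice_VC: "slice N g \<in> VC N"
  by (auto simp: slice_def VC_def zrep_swap)

text \<open>Points and parameter functions are both indexed by \<open>idx\<close>, so a point of S
  serves as its own parameter.\<close>

lemma slice_in_VC_eq:
  assumes v: "v \<in> VC N"
    and diag: "\<And>i j. i < N \<Longrightarrow> j < N \<Longrightarrow> i \<noteq> j \<Longrightarrow> v (Mu i j) = 0"
    and gauge: "\<And>k. k < N \<Longrightarrow> v (Z 0 0 0 k) = v (Z 0 0 k 0)"
  shows "slice N v = v"
proof
  fix x
  show "slice N v x = v x"
  proof (cases x)
    case (Mu i j)
    then show ?thesis using v diag[of i j] by (cases "i < N \<and> j < N") (auto simp: slice_def VC_def)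
  next
    case (Z i j k l)
    show ?thesis
    proof (cases "i < N \<and> j < N \<and> k < N \<and> l < N")
      case True
      have "v (gauge (Z a b c d)) = v (Z a b c d)" if "c < N" for a b c d
        using gauge[OF that] by (auto simp: gauge_def)
      moreover have "v (Z i j k l) = v (Z k l i j)" using v by (simp add: VC_def)
      ultimately show ?thesis using True Z by (auto simp: slice_def zrep_def)
    next
      case False
      then show ?thesis using Z v by (auto simp: slice_def VC_def)
    qed
  qed
qed

lemma slice_coord: "(\<forall>g. slice N g x = 0) \<or> (\<exists>c\<in>coords N. \<forall>g. slice N g x = g c)"
proof (cases x)
  case (Mu i j)
  then show ?thesis by (auto simp: slice_def coords_def eig_coords_def)
next
  case (Z i j k l)
  then show ?thesis using gauge_in_coords[of i N j k l] by (auto simp: slice_def)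
qed

lemma polyfun_slice_box_poly:
  assumes "p \<in> polyfun"
  shows "\<exists>D. (\<lambda>g. p (slice N g)) \<in> box_poly (coords N) D"
  using assms
proof induction
  case (const c)
  show ?case using box_poly_const[OF finite_coords] by blast
next
  case (coord x)
  show ?case
  proof (cases "\<forall>g. slice N g x = 0")
    case True
    then show ?thesis using box_poly_const[OF finite_coords, of 0] by simp
  next
    case False
    then obtain c where "c \<in> coords N" "\<And>g. slice N g x = g c" using slice_coord by blast
    then show ?thesis using box_poly_coord[OF finite_coords] by (intro exI[of _ 1]) simp
  qed
next
  case (add f g)
  then show ?case using box_poly_add[OF finite_coords] by blast
next
  case (mult f g)
  then show ?case using box_poly_mult[OF finite_coords] by blast
qed

lemma slice_line: "slice N (\<lambda>x. a x + t * b x) = (\<lambda>x. slice N a x + t * slice N b x)"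
  by (auto simp: slice_def split: idx.splits)

section \<open>The invariant ring as a function algebra\<close>

lemma inv_ring_eq: "inv_ring N = {restr N f |f. invariant N f}"
  by (simp add: inv_ring_def invariant_def)

lemma inv_ringE:
  assumes "f \<in> inv_ring N"
  obtains p where "invariant N p" "f = restr N p"
  using assms by (auto simp: inv_ring_eq)

lemma inv_ringI: "invariant N p \<Longrightarrow> restr N p \<in> inv_ring N"
  by (auto simp: inv_ring_eq)

lemma function_algebra_inv_ring: "function_algebra (inv_ring N) (restr N (\<lambda>_. 1))"
proof
  fix f :: "point \<Rightarrow> complex" and c assume "f \<in> inv_ring N"
  then obtain p where p: "invariant N p" "f = restr N p" by (rule inv_ringE)
  have "(\<lambda>v. c * f v) = restr N (\<lambda>v. c * p v)" by (auto simp: p restr_def)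
  then show "(\<lambda>v. c * f v) \<in> inv_ring N"
    using p by (simp add: inv_ringI invariant_mult invariant_const)
  show "(\<lambda>v. f v * restr N (\<lambda>_. 1) v) = f" by (auto simp: p restr_def)
next
  fix f g :: "point \<Rightarrow> complex" assume "f \<in> inv_ring N" "g \<in> inv_ring N"
  then obtain p q where p: "invariant N p" "f = restr N p" "invariant N q" "g = restr N q"
    by (metis inv_ringE)
  have "(\<lambda>v. f v + g v) = restr N (\<lambda>v. p v + q v)" "(\<lambda>v. f v * g v) = restr N (\<lambda>v. p v * q v)"
    by (auto simp: p restr_def)
  then show "(\<lambda>v. f v + g v) \<in> inv_ring N" "(\<lambda>v. f v * g v) \<in> inv_ring N"
    using p by (simp_all add: inv_ringI invariant_add invariant_mult)
next
  show "restr N (\<lambda>_. 1) \<in> inv_ring N"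
    by (simp add: inv_ringI invariant_const)
qed

section \<open>Restriction to the slice is injective\<close>

text \<open>\<open>unitary\<close> does not control entries outside the N x N block;
  \<open>SU\<close> requires them to vanish, and this keeps \<open>act\<close> inside
  \<open>VC\<close>.\<close>

definition in_box :: "nat \<Rightarrow> (nat \<Rightarrow> nat \<Rightarrow> complex) \<Rightarrow> bool" where
  "in_box N U \<longleftrightarrow> (\<forall>i j. N \<le> i \<or> N \<le> j \<longrightarrow> U i j = 0)"

text \<open>The original real space V inside its complexification.\<close>

definition real_point :: "point \<Rightarrow> bool" where
  "real_point v \<longleftrightarrow> (\<forall>i j. v (Mu i j) = cnj (v (Mu j i))) \<and> (\<forall>i j k l. v (Z i j k l) = cnj (v (Z j i l k)))"

lemma act_Z: "act N U v (Z i j k l) = (\<Sum>a<N. \<Sum>b<N. \<Sum>c<N. \<Sum>d<N.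
    (U i a * cnj (U j b)) * (U k c * cnj (U l d)) * v (Z a b c d))"
  by (simp add: act_def mult.assoc)

lemma act_VC:
  assumes U: "in_box N U" and v: "v \<in> VC N"
  shows "act N U v \<in> VC N"
proof -
  have "act N U v (Mu i j) = 0" if "N \<le> i \<or> N \<le> j" for i j
    using U that by (auto simp: act_def in_box_def intro!: sum.neutral)
  moreover have "act N U v (Z i j k l) = 0" if "N \<le> i \<or> N \<le> j \<or> N \<le> k \<or> N \<le> l" for i j k l
    using U that by (auto simp: act_def in_box_def intro!: sum.neutral)
  moreover have "act N U v (Z i j k l) = act N U v (Z k l i j)" for i j k l
  proof -
    have "v (Z a b c d) = v (Z c d a b)" for a b c d using v by (simp add: VC_def)
    then show ?thesis unfolding act_Z
      by (subst sum_swap_pairs) (intro sum.cong refl, simp add: mult_ac)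
  qed
  ultimately show ?thesis by (simp add: VC_def)
qed

lemma act_real_point:
  assumes "real_point v"
  shows "real_point (act N U v)"
proof -
  have "act N U v (Mu i j) = cnj (act N U v (Mu j i))" for i j
  proof -
    have "cnj (v (Mu a b)) = v (Mu b a)" for a b using assms by (metis real_point_def)
    then have "cnj (act N U v (Mu j i)) = (\<Sum>b<N. \<Sum>a<N. U i a * cnj (U j b) * v (Mu a b))"
      by (simp add: act_def mult_ac)
    also have "\<dots> = (\<Sum>a<N. \<Sum>b<N. U i a * cnj (U j b) * v (Mu a b))" by (rule sum.swap)
    finally have e: "cnj (act N U v (Mu j i)) = (\<Sum>a<N. \<Sum>b<N. U i a * cnj (U j b) * v (Mu a b))" .
    show ?thesis unfolding e by (simp add: act_def)
  qed
  moreover have "act N U v (Z i j k l) = cnj (act N U v (Z j i l k))" for i j k l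
  proof -
    have "cnj (v (Z a b c d)) = v (Z b a d c)" for a b c d using assms by (metis real_point_def)
    then have "cnj (act N U v (Z j i l k)) = (\<Sum>b<N. \<Sum>a<N. \<Sum>d<N. \<Sum>c<N.
        (U i a * cnj (U j b)) * (U k c * cnj (U l d)) * v (Z a b c d))"
      by (simp add: act_Z mult_ac)
    also have "\<dots> = (\<Sum>a<N. \<Sum>b<N. \<Sum>d<N. \<Sum>c<N.
        (U i a * cnj (U j b)) * (U k c * cnj (U l d)) * v (Z a b c d))"
      by (rule sum.swap)
    also have "\<dots> = act N U v (Z i j k l)"
      unfolding act_Z by (intro sum.cong refl sum.swap)
    finally show ?thesis by (rule sym)
  qed
  ultimately show ?thesis unfolding real_point_def by blast
qed

lemma SU_det:
  "(\<Sum>p | p permutes {..<N}. of_int (sign p) * (\<Prod>i<N. U i (p i))) = det (mat N N (\<lambda>(i, j). U i j))"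
  by (subst det_def'[of _ N], simp, unfold lessThan_atLeast0,
      intro sum.cong refl arg_cong2[where f = "(*)"] prod.cong)
    (auto simp: permutes_in_image)

lemma det_adj: "det (mat N N (\<lambda>(i, j). adj U i j)) = cnj (det (mat N N (\<lambda>(i, j). U i j)))"
proof -
  interpret comm_ring_hom cnj by unfold_locales auto
  let ?M = "mat N N (\<lambda>(i, j). U i j)"
  have "mat N N (\<lambda>(i, j). adj U i j) = transpose_mat (map_mat cnj ?M)"
    by (intro eq_matI) (auto simp: adj_def)
  moreover have "det (transpose_mat (map_mat cnj ?M)) = det (map_mat cnj ?M)"
    by (rule det_transpose[of _ N]) simp
  ultimately show ?thesis by simp
qed

text \<open>Scalar phases act trivially, so the determinant condition does not matter.\<close>

lemma unitary_act_SU: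
  assumes N: "1 \<le> N" and U: "unitary N U" "in_box N U"
  shows "\<exists>U'\<in>SU N. act N U' = act N U"
proof -
  define D where "D = det (mat N N (\<lambda>(i, j). U i j))"
  have "D * cnj D = 1" using det_unitary[OF U(1)] by (simp add: D_def det_adj)
  then have "(cmod D)\<^sup>2 = 1" by (metis complex_norm_square of_real_eq_1_iff)
  then have "cmod D = 1" by (simp add: power2_eq_1_iff) (metis norm_ge_zero not_one_le_zero neg_0_le_iff_le)
  then have D: "D = cis (Arg D)" by (metis rcis_cmod_Arg rcis_def mult_1 of_real_1)
  \<comment> \<open>An N-th root of 1 / D on the unit circle, so that c U has determinant 1.\<close>
  define c where "c = cis (- Arg D / real N)"
  have cN: "c ^ N * D = 1"
  proof -
    have "c ^ N = cis (- Arg D)" using N by (simp add: c_def DeMoivre)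
    then show ?thesis by (subst D) (simp add: cis_mult)
  qed
  have cc: "c * cnj c = 1" by (simp add: c_def cis_cnj cis_mult)
  define U' where "U' = (\<lambda>i j. c * U i j)"
  have h: "U' i a * cnj (U' j b) = U i a * cnj (U j b)" for i a j b
  proof -
    have "U' i a * cnj (U' j b) = (c * cnj c) * (U i a * cnj (U j b))" by (simp add: U'_def mult_ac)
    then show ?thesis by (simp add: cc)
  qed
  have "act N U' v x = act N U v x" for v x
  proof (cases x)
    case (Mu i j)
    then show ?thesis by (simp add: act_def h)
  next
    case (Z i j k l)
    then show ?thesis by (simp only: act_Z h)
  qed
  then have "act N U' = act N U" by (intro ext)
  moreover have "U' \<in> SU N"
  proof -
    have "(\<Sum>p | p permutes {..<N}. of_int (sign p) * (\<Prod>i<N. U' i (p i))) = c ^ N * D"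
      unfolding D_def SU_det[symmetric] U'_def
      by (simp add: prod.distrib sum_distrib_left mult_ac)
    then show ?thesis using U cN unfolding SU_def
      by (simp add: h) (auto simp: U'_def in_box_def unitary_def mm_def adj_def)
  qed
  ultimately show ?thesis by blast
qed

lemma invariant_unitary:
  assumes "1 \<le> N" "invariant N p" "unitary N U" "in_box N U" "v \<in> VC N"
  shows "p (act N U v) = p v"
  using unitary_act_SU[OF assms(1,3,4)] assms(2,5) unfolding invariant_def by metis

lemma act_diagonal:
  assumes "\<And>a b. U a b = (if a = b \<and> a < N then u a else 0)"
  shows "i < N \<Longrightarrow> j < N \<Longrightarrow> act N U v (Mu i j) = u i * cnj (u j) * v (Mu i j)"
    and "i < N \<Longrightarrow> j < N \<Longrightarrow> k < N \<Longrightarrow> l < N \<Longrightarrow>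
      act N U v (Z i j k l) = u i * cnj (u j) * u k * cnj (u l) * v (Z i j k l)"
proof -
  have pick: "(\<Sum>a<N. U i a * f a) = u i * f i" "(\<Sum>a<N. cnj (U i a) * f a) = cnj (u i) * f i"
    if "i < N" for i f
  proof -
    have "(\<Sum>a<N. U i a * f a) = (\<Sum>a<N. if a = i then u i * f i else 0)"
      "(\<Sum>a<N. cnj (U i a) * f a) = (\<Sum>a<N. if a = i then cnj (u i) * f i else 0)"
      using that by (intro sum.cong refl; simp add: assms)+
    then show "(\<Sum>a<N. U i a * f a) = u i * f i" "(\<Sum>a<N. cnj (U i a) * f a) = cnj (u i) * f i"
      using that by simp_all
  qed
  show "act N U v (Mu i j) = u i * cnj (u j) * v (Mu i j)" if "i < N" "j < N"
  proof -
    have "act N U v (Mu i j) = (\<Sum>a<N. U i a * (\<Sum>b<N. cnj (U j b) * v (Mu a b)))"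
      by (simp add: act_def sum_distrib_left mult.assoc)
    then show ?thesis using that by (simp add: pick mult.assoc)
  qed
  show "act N U v (Z i j k l) = u i * cnj (u j) * u k * cnj (u l) * v (Z i j k l)"
    if "i < N" "j < N" "k < N" "l < N"
  proof -
    have "act N U v (Z i j k l) = (\<Sum>a<N. U i a * (\<Sum>b<N. cnj (U j b) * (\<Sum>c<N. U k c *
        (\<Sum>d<N. cnj (U l d) * v (Z a b c d)))))"
      by (simp add: act_def sum_distrib_left mult.assoc)
    then show ?thesis using that by (simp add: pick mult.assoc)
  qed
qed

text \<open>On the real form z_00,k0 is the conjugate of z_00,0k, so it suffices to make z_00,0k real.\<close>

lemma real_point_to_slice:
  assumes N: "1 \<le> N" and v: "v \<in> VC N" "real_point v"
  shows "\<exists>g. \<forall>p. invariant N p \<longrightarrow> p v = p (slice N g)"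
proof -
  have "adj (\<lambda>a b. v (Mu a b)) i j = v (Mu i j)" for i j
    using v(2) by (metis adj_def real_point_def)
  then obtain U0 where U0: "unitary N U0"
    "\<And>i j. i < N \<Longrightarrow> j < N \<Longrightarrow> i \<noteq> j \<Longrightarrow> mm N U0 (mm N (\<lambda>a b. v (Mu a b)) (adj U0)) i j = 0"
    using spectral_theorem[of N "\<lambda>a b. v (Mu a b)"] by blast
  define U where "U = (\<lambda>i j. if i < N \<and> j < N then U0 i j else 0)"
  have U: "unitary N U" "in_box N U"
    using U0(1) by (auto simp: U_def unitary_def in_box_def mm_def adj_def)
  define w where "w = act N U v"
  have w: "w \<in> VC N" "real_point w" unfolding w_def by (rule act_VC[OF U(2) v(1)], rule act_real_point[OF v(2)])
  have wd: "w (Mu i j) = 0" if "i < N" "j < N" "i \<noteq> j" for i j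
  proof -
    have "w (Mu i j) = mm N U0 (mm N (\<lambda>a b. v (Mu a b)) (adj U0)) i j"
      unfolding w_def act_Mu using that by (auto simp: U_def adj_def mm_def intro!: sum.cong)
    then show ?thesis using U0(2) that by simp
  qed
  define z where "z = (\<lambda>k. w (Z 0 0 0 k))"
  \<comment> \<open>Since \<open>u 0 = 1\<close>, the diagonal matrix u multiplies z_(00,0k) by the
    conjugate of u_k alone, which turns it into its absolute value.\<close>
  define u where "u = (\<lambda>k. if k = 0 \<or> z k = 0 then 1 else z k / of_real (cmod (z k)))"
  define T where "T = (\<lambda>i j. if i = j \<and> i < N then u i else 0)"
  have uu: "u k * cnj (u k) = 1" for k
    by (auto simp: u_def complex_norm_square[symmetric] power2_eq_square norm_divide)
  have T: "in_box N T" "unitary N T"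
  proof -
    show "in_box N T" by (auto simp: in_box_def T_def)
    show "unitary N T" unfolding unitary_def mm_def adj_def
    proof (intro allI impI)
      fix i j assume "i < N" "j < N"
      then have "(\<Sum>k<N. T i k * cnj (T j k)) = (\<Sum>k<N. if k = i then (if i = j then u i * cnj (u i) else 0) else 0)"
        by (intro sum.cong) (auto simp: T_def)
      then show "(\<Sum>k<N. T i k * cnj (T j k)) = (if i = j then 1 else 0)"
        using \<open>i < N\<close> by (simp add: uu)
    qed
  qed
  define y where "y = act N T w"
  have y: "y \<in> VC N" "real_point y" unfolding y_def by (rule act_VC[OF T(1) w(1)], rule act_real_point[OF w(2)])
  note actT = act_diagonal[of T N u, unfolded T_def, OF refl, folded T_def]
  have "y (Mu i j) = 0" if "i < N" "j < N" "i \<noteq> j" for i j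
    using actT(1)[OF that(1,2)] wd[OF that] by (simp add: y_def)
  moreover have "y (Z 0 0 0 k) = y (Z 0 0 k 0)" if "k < N" for k
  proof (cases "k = 0")
    case False
    have "y (Z 0 0 0 k) = cnj (u k) * z k"
      using actT(2)[of 0 0 0 k w] that N by (simp add: y_def u_def z_def)
    also have "\<dots> = of_real (cmod (z k))"
      using False by (auto simp: u_def complex_norm_square[symmetric] mult.commute[of "cnj _"] power2_eq_square)
    finally have "cnj (y (Z 0 0 0 k)) = y (Z 0 0 0 k)" by simp
    then show ?thesis using y(2) by (metis real_point_def)
  qed simp
  ultimately have "slice N y = y" using y(1) by (intro slice_in_VC_eq) auto
  moreover have "p v = p y" if "invariant N p" for p
    unfolding y_def w_def
    by (simp add: invariant_unitary[OF N that] T U act_VC v)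
  ultimately show ?thesis by metis
qed

text \<open>The conjugation of V_C that fixes V pointwise sends v to the function
  \<open>\<lambda>x. cnj (v (conj_idx x))\<close>.\<close>

definition conj_idx :: "idx \<Rightarrow> idx" where
  "conj_idx x = (case x of Mu i j \<Rightarrow> Mu j i | Z i j k l \<Rightarrow> Z j i l k)"

text \<open>The real form is Zariski dense: every point is a + i b with a, b real.\<close>

lemma polyfun_zero_on_real_points:
  assumes p: "p \<in> polyfun" and zero: "\<And>v. v \<in> VC N \<Longrightarrow> real_point v \<Longrightarrow> p v = 0" and v: "v \<in> VC N"
  shows "p v = 0"
proof -
  define a where "a = (\<lambda>x. (v x + cnj (v (conj_idx x))) / 2)"
  define b where "b = (\<lambda>x. (v x - cnj (v (conj_idx x))) / (2 * \<i>))"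
  have VC: "(\<lambda>x. a x + of_real t * b x) \<in> VC N" for t
    using v by (auto simp: VC_def a_def b_def conj_idx_def)
  have real: "real_point (\<lambda>x. a x + of_real t * b x)" for t
    by (auto simp: real_point_def a_def b_def conj_idx_def field_simps)
  \<comment> \<open>On the complex line a + t b the polynomial vanishes for all real t, hence
    identically, in particular at t = \<i>, where the line passes through v.\<close>
  obtain P where P: "\<And>t. p (\<lambda>x. a x + t * b x) = poly P t" using polyfun_line[OF p] by blast
  have "poly P (of_real t) = 0" for t using zero[OF VC real, of t] by (simp add: P)
  then have "range complex_of_real \<subseteq> {t. poly P t = 0}" by auto
  moreover have "infinite (range complex_of_real)"
    by (simp add: finite_image_iff inj_def infinite_UNIV_char_0)
  ultimately have "P = 0" using poly_roots_finite finite_subset by blast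
  then have "p (\<lambda>x. a x + \<i> * b x) = 0" by (simp add: P)
  moreover have "(\<lambda>x. a x + \<i> * b x) = v" by (auto simp: a_def b_def field_simps)
  ultimately show ?thesis by simp
qed

text \<open>Every orbit of a real point meets S, so the invariant vanishes on the real form, and by
  density on all of V_C.\<close>

lemma inv_ring_zero_on_slice:
  assumes N: "1 \<le> N" and f: "f \<in> inv_ring N" and zero: "\<And>g. f (slice N g) = 0"
  shows "f = (\<lambda>_. 0)"
proof
  fix v
  obtain p where p: "invariant N p" "f = restr N p" using f by (rule inv_ringE)
  have "p v = 0" if "v \<in> VC N" "real_point v" for v
    using real_point_to_slice[OF N that] p zero slice_VC by (metis restr_def)
  then show "f v = 0"
    using polyfun_zero_on_real_points[of p N v] p by (auto simp: restr_def invariant_def)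
qed

section \<open>A chain of primes\<close>

text \<open>The distinct eigenvalues provide the projectors, and the phase coordinates equal to 1
  link index 0 to every other index.\<close>

definition base :: "idx \<Rightarrow> complex" where
  "base x = (case x of Mu i j \<Rightarrow> of_nat i
     | Z i j k l \<Rightarrow> if i = 0 \<and> j = 0 \<and> k = 0 \<and> 1 \<le> l then 1 else 0)"

definition flat :: "idx set \<Rightarrow> (idx \<Rightarrow> complex) set" where
  "flat F = {g. \<forall>x. x \<notin> F \<longrightarrow> g x = base x}"

text \<open>The ideal of invariants that vanish on the image under \<open>slice\<close> of the
  affine subspace through the base point with free directions F.\<close>

definition vanishing :: "nat \<Rightarrow> idx set \<Rightarrow> (point \<Rightarrow> complex) set" where
  "vanishing N F = {f \<in> inv_ring N. \<forall>g\<in>flat F. f (slice N g) = 0}"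

lemma restr_slice [simp]: "restr N p (slice N g) = p (slice N g)"
  by (simp add: restr_def slice_VC)

text \<open>An affine subspace is irreducible: if neither factor vanishes identically, join a point
  where the first is nonzero to one where the second is nonzero. On this line the product of two
  nonzero one-variable polynomials would be zero.\<close>

lemma vanishing_prime: "is_prime_ideal (inv_ring N) (vanishing N F)"
proof -
  interpret function_algebra "inv_ring N" "restr N (\<lambda>_. 1)" by (rule function_algebra_inv_ring)
  have base: "base \<in> flat F" by (simp add: flat_def)
  have "is_ideal (inv_ring N) (vanishing N F)"
    unfolding is_ideal_def
  proof (intro conjI ballI)
    fix f assume "f \<in> vanishing N F"
    then show "(\<lambda>v. - f v) \<in> vanishing N F"
      using scale_in[of f "-1"] by (auto simp: vanishing_def)
  qed (auto simp: vanishing_def intro: zero_in add_in mult_in)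
  moreover have "restr N (\<lambda>_. 1) \<notin> vanishing N F"
    using base by (auto simp: vanishing_def)
  then have "vanishing N F \<noteq> inv_ring N" using unit_in by blast
  moreover have "f1 \<in> vanishing N F \<or> f2 \<in> vanishing N F"
    if f: "f1 \<in> inv_ring N" "f2 \<in> inv_ring N" and prod: "(\<lambda>v. f1 v * f2 v) \<in> vanishing N F" for f1 f2
  proof (rule ccontr)
    assume "\<not> ?thesis"
    then obtain g1 g2 where g: "g1 \<in> flat F" "f1 (slice N g1) \<noteq> 0" "g2 \<in> flat F" "f2 (slice N g2) \<noteq> 0"
      using f by (auto simp: vanishing_def)
    obtain p1 where p1: "invariant N p1" "f1 = restr N p1" using f(1) by (rule inv_ringE)
    obtain p2 where p2: "invariant N p2" "f2 = restr N p2" using f(2) by (rule inv_ringE)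
    define h where "h = (\<lambda>t x. g1 x + t * (g2 x - g1 x))"
    have h: "h t \<in> flat F" for t using g by (auto simp: flat_def h_def)
    have line: "slice N (h t) = (\<lambda>x. slice N g1 x + t * slice N (\<lambda>x. g2 x - g1 x) x)" for t
      unfolding h_def by (rule slice_line)
    obtain P1 where P1: "\<And>t. p1 (slice N (h t)) = poly P1 t"
      unfolding line using polyfun_line p1(1) unfolding invariant_def by blast
    obtain P2 where P2: "\<And>t. p2 (slice N (h t)) = poly P2 t"
      unfolding line using polyfun_line p2(1) unfolding invariant_def by blast
    have "poly (P1 * P2) t = 0" for t
      using prod h[of t] by (auto simp: vanishing_def p1 p2 P1 P2)
    then have "P1 * P2 = 0" using poly_all_0_iff_0 by blast
    moreover have "poly P1 0 \<noteq> 0" using g(2) P1[of 0] p1 by (simp add: h_def)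
    moreover have "poly P2 1 \<noteq> 0" using g(4) P2[of 1] p2 by (simp add: h_def)
    ultimately show False by auto
  qed
  ultimately show ?thesis unfolding is_prime_ideal_def by blast
qed

lemma vanishing_antimono: "F \<subseteq> F' \<Longrightarrow> vanishing N F' \<subseteq> vanishing N F"
  by (auto simp: vanishing_def flat_def)

lemma vanishing_separates:
  assumes "invariant N f" "\<And>g. g \<in> flat F \<Longrightarrow> f (slice N g) = 0" "g \<in> flat F'" "f (slice N g) \<noteq> 0"
  shows "\<exists>f\<in>vanishing N F. f \<notin> vanishing N F'"
  using assms by (intro bexI[of _ "restr N f"]) (auto simp: vanishing_def inv_ringI)

section \<open>Invariants that detect a newly freed coordinate\<close>

lemma det_slice:
  "det (mat N N (\<lambda>(i, j). c * (if i = j then 1 else 0) + (- 1) * slice N g (Mu i j))) = (\<Prod>i<N. c - g (Mu i i))"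
proof -
  let ?M = "mat N N (\<lambda>(i, j). c * (if i = j then 1 else 0) + (- 1) * slice N g (Mu i j))"
  have "upper_triangular ?M" by (auto simp: slice_def)
  then have "det ?M = prod_list (diag_mat ?M)" by (rule det_upper_triangular[of _ N]) simp
  then show ?thesis by (simp add: prod_list_diag_prod slice_def lessThan_atLeast0)
qed

text \<open>The invariant det(k - mu) vanishes as long as the k-th eigenvalue is still k. It
  involves no projectors, so F may already contain other eigenvalues.\<close>

lemma separate_eig:
  assumes x: "x \<in> eig_coords N" "x \<notin> F"
  shows "\<exists>f\<in>vanishing N F. f \<notin> vanishing N (insert x F)"
proof -
  obtain k where k: "k < N" "x = Mu k k" using x by (auto simp: eig_coords_def)
  let ?f = "\<lambda>v. det (mat N N (\<lambda>(i, j). of_nat k * (if i = j then 1 else 0) + (- 1) * v (Mu i j)))"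
  show ?thesis
  proof (rule vanishing_separates)
    show "invariant N ?f"
      by (intro invariant_det covariant_lincomb covariant_one covariant_Mu)
    show "?f (slice N g) = 0" if "g \<in> flat F" for g
    proof -
      have "g (Mu k k) = of_nat k" using that x k by (auto simp: flat_def base_def)
      then show ?thesis unfolding det_slice using k(1) by (intro prod_zero bexI[of _ k]) auto
    qed
    \<comment> \<open>Moving the k-th eigenvalue to -1 removes k from the spectrum.\<close>
    show "base(x := - 1) \<in> flat (insert x F)" by (simp add: flat_def)
    have "of_nat k - (base(x := - 1)) (Mu i i) \<noteq> 0" for i
    proof (cases "i = k")
      case True
      have "(of_nat k + 1 :: complex) \<noteq> 0" by (metis of_nat_Suc add.commute of_nat_eq_0_iff nat.distinct(1))
      then show ?thesis using True by (simp add: k)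
    next
      case False
      then show ?thesis by (simp add: k base_def)
    qed
    then show "?f (slice N (base(x := - 1))) \<noteq> 0" unfolding det_slice by simp
  qed
qed

lemma diag_base_slice:
  assumes "g \<in> flat F" "F \<inter> eig_coords N = {}"
  shows "diag_base N (slice N g)"
proof -
  have "g (Mu a a) = of_nat a" if "a < N" for a
  proof -
    have "Mu a a \<notin> F" using that assms(2) by (auto simp: eig_coords_def)
    then show ?thesis using assms(1) by (simp add: flat_def base_def)
  qed
  then show ?thesis by (simp add: diag_base_def slice_def)
qed

text \<open>The matrix \<open>W\<close> has entries z_(ab,00), and the trace of E_0 W E_i W is W_0i
  W_i0.\<close>

lemma phase_invariant:
  assumes i: "i < N" and N: "0 < N"
  shows "\<exists>f. invariant N f \<and> (\<forall>v. diag_base N v \<longrightarrow> f v = v (Z 0 i 0 0) * v (Z i 0 0 0))"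
proof -
  obtain E where E: "\<And>i. covariant N (E i)" "\<And>i v a b. diag_base N v \<Longrightarrow> a < N \<Longrightarrow> b < N \<Longrightarrow>
      E i v a b = (if a = i \<and> b = i then 1 else 0)"
    using projector_exists[of N] by metis
  define W where "W = (\<lambda>v. contr N v (E 0 v))"
  have W: "covariant N W" unfolding W_def by (intro covariant_contr E(1))
  have "(\<Sum>a<N. mm N (E 0 v) (mm N (W v) (mm N (E i v) (W v))) a a) = v (Z 0 i 0 0) * v (Z i 0 0 0)"
    if v: "diag_base N v" for v
  proof -
    have Wv: "W v a b = v (Z a b 0 0)" for a b
      unfolding W_def using N E(2)[OF v] by (intro contr_unit) auto
    have "(\<Sum>a<N. mm N (E 0 v) (mm N (W v) (mm N (E i v) (W v))) a a)
        = (\<Sum>a<N. if a = 0 then v (Z 0 i 0 0) * v (Z i 0 0 0) else 0)"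
      using E(2)[OF v] N i
      by (intro sum.cong refl) (simp add: mm_unit_left[of 0] mm_unit_middle[of i N "E i v"] Wv)
    then show ?thesis using N by simp
  qed
  moreover have "invariant N (\<lambda>v. \<Sum>a<N. mm N (E 0 v) (mm N (W v) (mm N (E i v) (W v))) a a)"
    by (intro invariant_trace covariant_mm W E(1))
  ultimately show ?thesis by blast
qed

lemma separate_phase:
  assumes x: "x \<in> phase_coords N" "x \<notin> F" and F: "F \<inter> eig_coords N = {}"
  shows "\<exists>f\<in>vanishing N F. f \<notin> vanishing N (insert x F)"
proof -
  obtain i where i: "1 \<le> i" "i < N" "x = Z 0 0 0 i" using x by (auto simp: phase_coords_def)
  then obtain f where f: "invariant N f" "\<And>v. diag_base N v \<Longrightarrow> f v = v (Z 0 i 0 0) * v (Z i 0 0 0)"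
    using phase_invariant[of i N] by auto
  \<comment> \<open>By symmetry these entries equal z_(00,0i) and z_(00,i0), which coincide on S;
    the invariant is thus the square of the phase coordinate.\<close>
  have slice: "slice N g (Z 0 i 0 0) = g x" "slice N g (Z i 0 0 0) = g x" for g
    using i by (simp_all add: slice_def zrep_def gauge_def)
  have xe: "insert x F \<inter> eig_coords N = {}" using F i by (auto simp: eig_coords_def)
  show ?thesis
  proof (rule vanishing_separates)
    \<comment> \<open>The square minus 1 vanishes at the base value 1 and is 3 at the test value
      2.\<close>
    show "invariant N (\<lambda>v. f v + (- 1))" by (intro invariant_add f invariant_const)
    show "f (slice N g) + (- 1) = 0" if "g \<in> flat F" for g
    proof -
      have "g x = 1" using that x i by (auto simp: flat_def base_def)
      then show ?thesis by (simp add: f(2)[OF diag_base_slice[OF that F]] slice)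
    qed
    show g: "base(x := 2) \<in> flat (insert x F)" by (simp add: flat_def)
    show "f (slice N (base(x := 2))) + (- 1) \<noteq> 0"
      by (simp add: f(2)[OF diag_base_slice[OF g xe]] slice)
  qed
qed

text \<open>\<open>T j i\<close> = E_j W' E_0 W' E_i is the matrix unit at (j, i), because row 0 and
  column 0 of \<open>W'\<close> consist of ones. Contracting z with \<open>T l k\<close> leaves the
  matrix z_(ab,kl), and the trace against \<open>T j i\<close> extracts its (i, j) entry.\<close>

lemma entry_invariant:
  assumes ijkl: "i < N" "j < N" "k < N" "l < N"
  shows "\<exists>f. invariant N f \<and> (\<forall>v. diag_base N v \<longrightarrow>
     (\<forall>a<N. 1 \<le> a \<longrightarrow> v (Z a 0 0 0) = 1 \<and> v (Z 0 a 0 0) = 1) \<longrightarrow> f v = v (Z i j k l))"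
proof -
  have N: "0 < N" using ijkl by simp
  obtain E where E: "\<And>i. covariant N (E i)" "\<And>i v a b. diag_base N v \<Longrightarrow> a < N \<Longrightarrow> b < N \<Longrightarrow>
      E i v a b = (if a = i \<and> b = i then 1 else 0)"
    using projector_exists[of N] by metis
  define W where "W = (\<lambda>v. contr N v (E 0 v))"
  \<comment> \<open>W + E_0 - E_0 W E_0: the corner entry z_(00,00) of \<open>W\<close>, which is a
    free coordinate, is replaced by 1. The numerical factors fit the form of
    \<open>covariant_lincomb\<close>.\<close>
  define W' where "W' = (\<lambda>v a b. 1 * (1 * W v a b + 1 * E 0 v a b)
     + (- 1) * mm N (E 0 v) (mm N (W v) (E 0 v)) a b)"
  define T where "T = (\<lambda>j i v. mm N (E j v) (mm N (W' v) (mm N (E 0 v) (mm N (W' v) (E i v)))))"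
  have W: "covariant N W" unfolding W_def by (intro covariant_contr E(1))
  have W': "covariant N W'" unfolding W'_def by (intro covariant_lincomb covariant_mm W E(1))
  have T: "covariant N (T j i)" for j i unfolding T_def by (intro covariant_mm W' E(1))
  define f where "f = (\<lambda>v. \<Sum>a<N. mm N (contr N v (T l k v)) (T j i v) a a)"
  have "f v = v (Z i j k l)" if v: "diag_base N v"
    and one: "\<And>a. a < N \<Longrightarrow> 1 \<le> a \<Longrightarrow> v (Z a 0 0 0) = 1 \<and> v (Z 0 a 0 0) = 1" for v
  proof -
    have Wv: "W v a b = v (Z a b 0 0)" for a b
      unfolding W_def using N E(2)[OF v] by (intro contr_unit) auto
    have W'v: "W' v a 0 = 1" "W' v 0 a = 1" if "a < N" for a
      using one[OF that] that N E(2)[OF v]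
      by (auto simp: W'_def Wv mm_unit_left[of 0] mm_unit_right[of 0])
    have Tv: "T q p v a b = (if a = q \<and> b = p then 1 else 0)" if "a < N" "b < N" "q < N" "p < N" for a b q p
      unfolding T_def using that E(2)[OF v] N
      by (simp add: mm_unit_left[of q] mm_unit_middle[of 0 N "E 0 v"] mm_unit_right[of p] W'v)
    have contr: "contr N v (T l k v) a b = v (Z a b k l)" for a b
      using ijkl Tv by (intro contr_unit) auto
    have "f v = (\<Sum>a<N. if a = i then v (Z i j k l) else 0)"
      unfolding f_def mm_def contr using Tv ijkl
      by (intro sum.cong refl, subst sum.cong[OF refl, of _ _ "\<lambda>b. if b = j then (if a = i then v (Z i j k l) else 0) else 0" for a]) auto
    then show ?thesis using ijkl by simp
  qed
  moreover have "invariant N f" unfolding f_def by (intro invariant_trace covariant_mm covariant_contr T)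
  ultimately show ?thesis by blast
qed

text \<open>While only free coordinates vary, mu and all phase coordinates keep their base values,
  so \<open>entry_invariant\<close> reads off x itself: it is 0 before x is freed and can be 1
  afterwards.\<close>

lemma separate_free:
  assumes x: "x \<in> free_coords N" "x \<notin> F" and F: "F \<subseteq> free_coords N"
  shows "\<exists>f\<in>vanishing N F. f \<notin> vanishing N (insert x F)"
proof -
  obtain i j k l where ijkl: "i < N" "j < N" "k < N" "l < N" "x = zrep i j k l"
    using x by (auto simp: free_coords_def quartic_coords_def)
  obtain f where f: "invariant N f" "\<And>v. diag_base N v \<Longrightarrow>
      (\<And>a. a < N \<Longrightarrow> 1 \<le> a \<Longrightarrow> v (Z a 0 0 0) = 1 \<and> v (Z 0 a 0 0) = 1) \<Longrightarrow> f v = v (Z i j k l)"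
    using entry_invariant[OF ijkl(1-4)] by blast
  obtain a b c d where abcd: "x = Z a b c d" "c < N" "d < N"
    using ijkl by (auto simp: zrep_def split: if_splits)
  have "gauge x = x"
    using x abcd by (cases "c = 0") (auto simp: gauge_def free_coords_def image_iff)
  then have slice: "slice N g (Z i j k l) = g x" for g
    using ijkl by (simp add: slice_def)
  have base0: "base x = 0"
    using x abcd by (auto simp: base_def free_coords_def phase_coords_def)
  have free: "free_coords N \<inter> eig_coords N = {}" "free_coords N \<inter> phase_coords N = {}"
    by (auto simp: free_coords_def quartic_coords_def eig_coords_def zrep_def split: if_splits)
  have val: "f (slice N g) = g x" if g: "g \<in> flat G" and G: "G \<subseteq> free_coords N" for g G
  proof -
    have "slice N g (Z a 0 0 0) = 1 \<and> slice N g (Z 0 a 0 0) = 1" if a: "a < N" "1 \<le> a" for a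
    proof -
      have "Z 0 0 0 a \<notin> G" using a free(2) G by (auto simp: phase_coords_def)
      then have "g (Z 0 0 0 a) = 1" using g a by (simp add: flat_def base_def)
      then show ?thesis using a by (simp add: slice_def zrep_def gauge_def)
    qed
    moreover have "diag_base N (slice N g)" using g free(1) G by (intro diag_base_slice[of g G]) auto
    ultimately show ?thesis by (simp add: f(2) slice)
  qed
  show ?thesis
  proof (rule vanishing_separates)
    show "invariant N f" by (rule f(1))
    show "f (slice N g) = 0" if "g \<in> flat F" for g
      using val[OF that F] that x(2) base0 by (auto simp: flat_def)
    show g: "base(x := 1) \<in> flat (insert x F)" by (simp add: flat_def)
    show "f (slice N (base(x := 1))) \<noteq> 0"
      using val[OF g] x(1) F by simp
  qed
qed

lemma prime_chain:
  "\<exists>P. (\<forall>i\<le>card (coords N). is_prime_ideal (inv_ring N) (P i)) \<and> (\<forall>i<card (coords N). P i \<subset> P (Suc i))"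
proof -
  have fin: "finite (free_coords N)" "finite (phase_coords N)" "finite (eig_coords N)"
    using finite_coords[of N] by (auto simp: coords_def)
  obtain xs1 xs2 xs3 where xs:
    "set xs1 = free_coords N" "distinct xs1" "set xs2 = phase_coords N" "distinct xs2"
    "set xs3 = eig_coords N" "distinct xs3"
    using fin by (metis finite_distinct_list)
  have disj: "free_coords N \<inter> phase_coords N = {}" "free_coords N \<inter> eig_coords N = {}"
    "phase_coords N \<inter> eig_coords N = {}"
    by (auto simp: free_coords_def quartic_coords_def phase_coords_def eig_coords_def zrep_def split: if_splits)
  \<comment> \<open>The order matters: \<open>separate_free\<close> needs eigenvalues and phase
    coordinates still fixed, \<open>separate_phase\<close> needs the eigenvalues fixed, and
    \<open>separate_eig\<close> accepts any F.\<close>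
  define xs where "xs = xs1 @ xs2 @ xs3"
  have dist: "distinct xs" using xs disj by (auto simp: xs_def)
  have "set xs = coords N" using xs by (auto simp: xs_def coords_def)
  then have len: "length xs = card (coords N)" using dist distinct_card by metis
  have step: "vanishing N (set (take (Suc m) xs)) \<subset> vanishing N (set (take m xs))" if m: "m < length xs" for m
  proof -
    let ?F = "set (take m xs)" and ?x = "xs ! m"
    have ins: "set (take (Suc m) xs) = insert ?x ?F" using m by (simp add: take_Suc_conv_app_nth)
    have new: "?x \<notin> ?F"
      using dist m by (metis distinct_take take_Suc_conv_app_nth not_distinct_conv_prefix distinct_append
          disjoint_insert(1) list.set_intros(1) Int_iff empty_iff)
    have "\<exists>f\<in>vanishing N ?F. f \<notin> vanishing N (insert ?x ?F)"
    proof (cases "m < length xs1")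
      case True
      then have "?F = set (take m xs1)" "?x = xs1 ! m" by (auto simp: xs_def nth_append)
      then show ?thesis using separate_free[of ?x N ?F] new True xs(1)
        by (metis nth_mem set_take_subset)
    next
      case 1: False
      show ?thesis
      proof (cases "m < length xs1 + length xs2")
        case True
        have "?F \<subseteq> free_coords N \<union> phase_coords N"
          using 1 True xs(1,3) by (auto simp: xs_def dest: in_set_takeD)
        moreover have "m - length xs1 < length xs2" using 1 True by linarith
        then have "?x \<in> phase_coords N"
          using 1 by (simp add: xs_def nth_append flip: xs(3))
        ultimately show ?thesis using separate_phase[of ?x N ?F] new disj by blast
      next
        case False
        have "m - length xs1 - length xs2 < length xs3" "\<not> m - length xs1 < length xs2"
          using 1 False m unfolding xs_def length_append by linarith+
        then have "?x \<in> eig_coords N"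
          using 1 False by (simp add: xs_def nth_append flip: xs(5))
        then show ?thesis using separate_eig new by blast
      qed
    qed
    moreover have "vanishing N (insert ?x ?F) \<subseteq> vanishing N ?F" by (rule vanishing_antimono) auto
    ultimately show ?thesis unfolding ins by blast
  qed
  \<comment> \<open>Freeing coordinates shrinks the ideal, so the list is traversed backwards:
    \<open>?P 0\<close> belongs to the whole slice, the last ideal to the base point alone.\<close>
  let ?P = "\<lambda>i. vanishing N (set (take (length xs - i) xs))"
  have "?P i \<subset> ?P (Suc i)" if "i < length xs" for i
    using step[of "length xs - Suc i"] that by (simp add: Suc_diff_Suc)
  then show ?thesis using vanishing_prime by (intro exI[of _ ?P]) (simp add: len)
qed

theorem theorem4:
  fixes N :: nat
  assumes "1 \<le> N"
  shows "krull_dim (inv_ring N) = enat ((N^4 + N^2 + 2) div 2)"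
proof -
  interpret function_algebra "inv_ring N" "restr N (\<lambda>_. 1)" by (rule function_algebra_inv_ring)
  have deg: "\<exists>D. (\<lambda>g. f (slice N g)) \<in> box_poly (coords N) D" if "f \<in> inv_ring N" for f
    using that polyfun_slice_box_poly by (auto simp: inv_ring_eq invariant_def)
  \<comment> \<open>\<open>slice N\<close> is the parametrisation to which
    \<open>chain_length_le\<close> is applied.\<close>
  have upper: "n \<le> card (coords N)"
    if "\<forall>i\<le>n. is_prime_ideal (inv_ring N) (P i)" "\<forall>i<n. P i \<subset> P (Suc i)" for n P
    using that
    by (intro chain_length_le[of "coords N" "slice N" n P])
      (auto simp: finite_coords deg intro: inv_ring_zero_on_slice[OF assms])
  have "krull_dim (inv_ring N) = enat (card (coords N))"
  proof (rule antisym)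
    show "krull_dim (inv_ring N) \<le> enat (card (coords N))"
      unfolding krull_dim_def using upper by (intro Sup_least) auto
    show "enat (card (coords N)) \<le> krull_dim (inv_ring N)"
      unfolding krull_dim_def using prime_chain[of N] by (intro Sup_upper) blast
  qed
  then show ?thesis using card_coords[OF assms] by simp
qed

end
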